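(* The operation $\sigma_1\circ\sigma_2:=D(\sigma_1*\sigma_2)$ turns $LC$ and $LC_B$ into commutative unital rings where the unity is given by $\mathds{1}_{[0,\infty)}$. Moreover, the subgroup $LC'_B\subset LC_B$ is an ideal with respect to this ring structure. Furthermore, there is a ring isomorphism $\theta:\Lambda\xrightarrow{\ \cong\ }LC$, uniquely defined by the property that $\theta(t^a)=\mathds{1}_{[a,\infty)}$. The restriction of $\theta$ to $\Lambda_P\subset\Lambda$ gives a ring isomorphism $\Lambda_P\xrightarrow{\ \cong\ }LC_B$, and $\theta$ sends the ideal $\Lambda_P^{(0)}$ to $LC'_B$.
   Context: $\mathds 1_S$ denotes the indicator function of $S\subset\mathbb R$. $\mathcal I$ is the collection of intervals $[a,b)$ with $a\in\mathbb R$, $a<b\le\infty$. $LC_B$ is the group of functions $\mathbb R\to\mathbb R$ of the form $\sum_{\text{finite}}n_I\mathds 1_I$ with $I\in\mathcal I$, $n_I\in\mathbb Z$; $LC'_B\subset LC_B$ is the subgroup of such finite sums over intervals $I\in\mathcal I$ of finite length. $LC$ is the group of functions $\mathbb R\to\mathbb R$ of the form $\sum_{I\in\mathcal I_0}n_I\mathds 1_I$, $n_I\in\mathbb Z$, where $\mathcal I_0\subset\mathcal I$ is either finite or $\mathcal I_0=\{[a_j,b_j)\}_{j\in\mathbb N}$ with $a_j\to\infty$. A locally integrable function $f$ is identified with the regular distribution $\phi\mapsto\int f\phi\,dx$; $*$ is convolution, $(f*g)(x)=\int_{\mathbb R}f(x-y)g(y)\,dy$, and $D$ is the distributional derivative.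 $D(\sigma_1*\sigma_2)$ is a priori a distribution; part of the assertion is that it is a regular distribution given by a function of $LC$ (respectively $LC_B$), and $\sigma_1\circ\sigma_2$ denotes this function. Novikov rings: $\Lambda=\{\sum_{k=0}^\infty n_kt^{a_k}\mid n_k\in\mathbb Z,\ a_k\in\mathbb R,\ a_k\to\infty\}$ with the standard multiplication, $\Lambda_P\subset\Lambda$ the subring of finite sums, and $\Lambda_P^{(0)}=\{P\in\Lambda_P\mid P(1)=0\}$. *)

theory Defs
  imports "HOL-Analysis.Analysis" "HOL-Algebra.Algebra"
begin

definition test_functions :: "(real \<Rightarrow> real) set" where
  "test_functions = {\<phi>. (\<forall>n x. (deriv ^^ n) \<phi> differentiable (at x)) \<and>
                         compact (closure {x. \<phi> x \<noteq> 0})}"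

definition locally_integrable :: "(real \<Rightarrow> real) \<Rightarrow> bool" where
  "locally_integrable f \<longleftrightarrow> (\<forall>K. compact K \<longrightarrow> f absolutely_integrable_on K)"

text \<open>
  Distributions are represented as functionals that are undefined outside the test functions,
  so that equality of distributions is equality in HOL.
\<close>

definition regular_distribution :: "(real \<Rightarrow> real) \<Rightarrow> (real \<Rightarrow> real) \<Rightarrow> real" where
  "regular_distribution f = (\<lambda>\<phi>\<in>test_functions. LINT x|lebesgue. f x * \<phi> x)"

definition distributional_deriv ::
    "((real \<Rightarrow> real) \<Rightarrow> real) \<Rightarrow> (real \<Rightarrow> real) \<Rightarrow> real" where
  "distributional_deriv T = (\<lambda>\<phi>\<in>test_functions. - T (deriv \<phi>))"

definition convolution :: "(real \<Rightarrow> real) \<Rightarrow> (real \<Rightarrow> real) \<Rightarrow> real \<Rightarrow> real" where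
  "convolution f g = (\<lambda>x. LINT y|lebesgue. f (x - y) * g y)"

definition half_open :: "real \<Rightarrow> ereal \<Rightarrow> real set" where
  "half_open a b = {x. a \<le> x \<and> ereal x < b}"

definition intervals :: "real set set" where
  "intervals = {half_open a b | a b. ereal a < b}"

definition finite_intervals :: "real set set" where
  "finite_intervals = {half_open a b | a b. ereal a < b \<and> b < \<infinity>}"

text \<open>
  In all uses below only finitely many members of the family contain a given point, so the
  infinite sum is pointwise a finite sum.
\<close>

definition step_sum :: "real set set \<Rightarrow> (real set \<Rightarrow> int) \<Rightarrow> real \<Rightarrow> real" where
  "step_sum \<I>\<^sub>0 n = (\<lambda>x. \<Sum>\<^sub>\<infinity>I\<in>\<I>\<^sub>0. of_int (n I) * indicat_real I x)"

definition LC\<^sub>B :: "(real \<Rightarrow> real) set" where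
  "LC\<^sub>B = {step_sum \<I>\<^sub>0 n | \<I>\<^sub>0 n. finite \<I>\<^sub>0 \<and> \<I>\<^sub>0 \<subseteq> intervals}"

definition LC\<^sub>B' :: "(real \<Rightarrow> real) set" where
  "LC\<^sub>B' = {step_sum \<I>\<^sub>0 n | \<I>\<^sub>0 n. finite \<I>\<^sub>0 \<and> \<I>\<^sub>0 \<subseteq> finite_intervals}"

definition LC :: "(real \<Rightarrow> real) set" where
  "LC = {step_sum \<I>\<^sub>0 n | \<I>\<^sub>0 n. \<I>\<^sub>0 \<subseteq> intervals \<and>
           (finite \<I>\<^sub>0 \<or>
            (\<exists>(a :: nat \<Rightarrow> real) (b :: nat \<Rightarrow> ereal).
               (\<forall>j. ereal (a j) < b j) \<and> filterlim a at_top sequentially \<and>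
               \<I>\<^sub>0 = range (\<lambda>j. half_open (a j) (b j))))}"

definition circ :: "(real \<Rightarrow> real) \<Rightarrow> (real \<Rightarrow> real) \<Rightarrow> real \<Rightarrow> real" where
  "circ \<sigma>\<^sub>1 \<sigma>\<^sub>2 = (THE \<sigma>. \<sigma> \<in> LC \<and>
     distributional_deriv (regular_distribution (convolution \<sigma>\<^sub>1 \<sigma>\<^sub>2)) = regular_distribution \<sigma>)"

definition LC_ring :: "(real \<Rightarrow> real) ring" where
  "LC_ring = \<lparr>carrier = LC, monoid.mult = circ, one = indicat_real {0..},
              ring.zero = (\<lambda>_. 0), ring.add = (\<lambda>\<sigma>\<^sub>1 \<sigma>\<^sub>2 x. \<sigma>\<^sub>1 x + \<sigma>\<^sub>2 x)\<rparr>"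

text \<open>
  An element of the Novikov ring is represented by its coefficient function: \<open>P a\<close> is the
  coefficient of \<open>t\<^sup>a\<close>. Thus \<open>\<Sum>\<^sub>k n\<^sub>k t\<^bsup>a\<^sub>k\<^esup>\<close> has at \<open>x\<close> the coefficient \<open>\<Sum>{n\<^sub>k | a\<^sub>k = x}\<close>,
  a finite sum because \<open>a\<^sub>k\<close> tends to infinity.
\<close>

definition \<Lambda> :: "(real \<Rightarrow> int) set" where
  "\<Lambda> = {(\<lambda>x. \<Sum>k | a k = x. n k) | (n :: nat \<Rightarrow> int) a. filterlim a at_top sequentially}"

definition \<Lambda>\<^sub>P :: "(real \<Rightarrow> int) set" where
  "\<Lambda>\<^sub>P = {(\<lambda>x. \<Sum>k | k < N \<and> a k = x. n k) | (N :: nat) n a. True}"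

definition eval_at_one :: "(real \<Rightarrow> int) \<Rightarrow> int" where
  "eval_at_one P = (\<Sum>a | P a \<noteq> 0. P a)"

definition \<Lambda>\<^sub>P\<^sub>0 :: "(real \<Rightarrow> int) set" where
  "\<Lambda>\<^sub>P\<^sub>0 = {P \<in> \<Lambda>\<^sub>P. eval_at_one P = 0}"

definition t_power :: "real \<Rightarrow> real \<Rightarrow> int" where
  "t_power a = (\<lambda>x. if x = a then 1 else 0)"

text \<open>The index set in the product is finite for \<open>P, Q \<in> \<Lambda>\<close>.\<close>

definition novikov_mult :: "(real \<Rightarrow> int) \<Rightarrow> (real \<Rightarrow> int) \<Rightarrow> real \<Rightarrow> int" where
  "novikov_mult P Q = (\<lambda>x. \<Sum>a | P a \<noteq> 0 \<and> Q (x - a) \<noteq> 0. P a * Q (x - a))"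

definition Novikov_ring :: "(real \<Rightarrow> int) ring" where
  "Novikov_ring = \<lparr>carrier = \<Lambda>, monoid.mult = novikov_mult, one = t_power 0,
                   ring.zero = (\<lambda>_. 0), ring.add = (\<lambda>P Q x. P x + Q x)\<rparr>"

end

theory Submission
  imports Defs "HOL-Computational_Algebra.Polynomial"
begin

text \<open>
  A function in \<open>LC\<close> is a right-continuous step function with integer jumps, finitely many of them to the left of
  any given point, and it vanishes near \<open>-\<infinity>\<close>. It is therefore the same as its jumps: recording the height of
  the jump at \<open>a\<close> as the coefficient of \<open>t\<^sup>a\<close> gives a Novikov series, and every Novikov
  series \<open>P\<close> arises in this way from \<open>\<theta> P = (\<lambda>x. \<Sum>a\<le>x. P a)\<close>, here called \<open>step_of P\<close>
  (\<open>LC_eq_image\<close>). Finite sums of intervals correspond to finite sums of powers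
  (\<open>LC\<^sub>B_eq_image\<close>), and since the bounded interval \<open>[a, b)\<close> corresponds to \<open>t\<^sup>a - t\<^sup>b\<close>,
  sums of bounded intervals correspond to finite sums with coefficient sum zero
  (\<open>LC\<^sub>B'_eq_image\<close>).

  The product is explained by one computation. The convolution of the indicators of \<open>[a, \<infinity>)\<close> and
  \<open>[b, \<infinity>)\<close> is the ramp \<open>x \<mapsto> max 0 (x - (a + b))\<close>, and the derivative of this ramp is the indicator
  of \<open>[a + b, \<infinity>)\<close>. Thus \<open>D (\<sigma>\<^sub>1 * \<sigma>\<^sub>2)\<close> corresponds to the product of Novikov series
  (\<open>distributional_deriv_convolution\<close>). On any half-line bounded above, only finitely many exponents
  matter, which reduces the general case to finite sums. That a distribution determines its step
  function follows by testing with a bump function to the right of the first jump at which two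
  step functions differ (\<open>regular_distribution_step_of_inj\<close>). All ring-theoretic assertions about
  \<open>LC\<close> are then transported from the Novikov ring along \<open>\<theta>\<close>.

  The uniqueness of \<open>\<theta>\<close> is the least obvious part, because a ring isomorphism is not required to
  respect infinite sums. It amounts to saying that an endomorphism \<open>\<psi>\<close> of \<open>\<Lambda>\<close> with
  \<open>\<psi> (t\<^sup>a) = t\<^sup>a\<close> for all \<open>a\<close> is the identity. Such a \<open>\<psi>\<close> fixes finite sums, so it is enough that it
  does not decrease the valuation. Now \<open>1 + 2 t\<^sup>a f\<close> is a unit of \<open>\<Lambda>\<close> when \<open>t\<^sup>a f\<close> has
  positive valuation, by the geometric series. It is not a unit when \<open>t\<^sup>a f\<close> has negative valuation, since
  its leading coefficient is then even while a unit has leading coefficient \<open>1\<close> or \<open>-1\<close>. Units are preserved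
  by \<open>\<psi>\<close>, and varying \<open>a\<close> bounds the valuation of \<open>\<psi> f\<close> by that of \<open>f\<close> from below
  (\<open>vanishes_below_image\<close>).
\<close>

section \<open>Supports that are finite to the left\<close>

text \<open>
  The functions with this property turn out to be exactly the elements of \<open>\<Lambda>\<close>: the sequence of
  exponents in the definition of \<open>\<Lambda>\<close> disappears, and only the local finiteness of the
  support towards \<open>-\<infinity>\<close> remains.
\<close>

definition left_finite :: "(real \<Rightarrow> int) \<Rightarrow> bool" where
  "left_finite P \<longleftrightarrow> (\<forall>c. finite {a. a \<le> c \<and> P a \<noteq> 0})"

definition exponents_upto :: "real \<Rightarrow> (real \<Rightarrow> int) \<Rightarrow> real set" where
  "exponents_upto c P = {a. a \<le> c \<and> P a \<noteq> 0}"

text \<open>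
  The valuation of \<open>P\<close> is at least \<open>d\<close>. Bounds replace the valuation itself because the
  zero series, which satisfies all of them, has infinite valuation.
\<close>

definition vanishes_below :: "real \<Rightarrow> (real \<Rightarrow> int) \<Rightarrow> bool" where
  "vanishes_below d P \<longleftrightarrow> (\<forall>a<d. P a = 0)"

lemma finite_exponents_upto [simp]: "left_finite P \<Longrightarrow> finite (exponents_upto c P)"
  by (simp add: left_finite_def exponents_upto_def)

lemma vanishes_belowD: "vanishes_below d P \<Longrightarrow> a < d \<Longrightarrow> P a = 0"
  by (simp add: vanishes_below_def)

lemma vanishes_below_mono: "vanishes_below d P \<Longrightarrow> d' \<le> d \<Longrightarrow> vanishes_below d' P"
  by (auto simp: vanishes_below_def)

lemma left_finite_least_exponent:
  assumes "left_finite P" "P a \<noteq> 0"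
  obtains s where "P s \<noteq> 0" "vanishes_below s P" "s \<le> a"
proof -
  have fin: "finite (exponents_upto a P)" and ne: "exponents_upto a P \<noteq> {}"
    using assms by (auto simp: exponents_upto_def left_finite_def)
  let ?s = "Min (exponents_upto a P)"
  have mem: "?s \<in> exponents_upto a P" using Min_in[OF fin ne] .
  have van: "P b = 0" if "b < ?s" for b
  proof -
    have "b \<notin> exponents_upto a P" using Min_le[OF fin, of b] that by linarith
    moreover have "b \<le> a" using that mem unfolding exponents_upto_def by simp
    ultimately show ?thesis by (simp add: exponents_upto_def)
  qed
  show ?thesis
  proof (rule that)
    show "P ?s \<noteq> 0" "?s \<le> a" using mem unfolding exponents_upto_def by simp_all
    show "vanishes_below ?s P" unfolding vanishes_below_def using van by blast
  qed
qed

lemma left_finite_imp_vanishes_below: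
  assumes "left_finite P"
  obtains d where "vanishes_below d P"
proof (cases "\<exists>a. P a \<noteq> 0")
  case True
  then show ?thesis using left_finite_least_exponent[OF assms] that by metis
next
  case False
  then show ?thesis using that[of 0] by (simp add: vanishes_below_def)
qed

text \<open>
  A bound that serves both factors keeps the estimates for products free of case distinctions;
  taking it nonpositive ensures that bounds for single factors also serve for products, whose
  lower bounds add up.
\<close>

lemma left_finite_common_bound:
  assumes "left_finite P" "left_finite Q"
  obtains d where "vanishes_below d P" "vanishes_below d Q" "d \<le> 0"
proof -
  obtain d e where "vanishes_below d P" "vanishes_below e Q"
    using assms left_finite_imp_vanishes_below by metis
  then show ?thesis
    using that[of "min 0 (min d e)"] vanishes_below_mono[of d P] vanishes_below_mono[of e Q] by simp
qed

lemma left_finite_zero: "left_finite (\<lambda>_. 0)"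
  by (simp add: left_finite_def)

lemma left_finite_add: "left_finite P \<Longrightarrow> left_finite Q \<Longrightarrow> left_finite (\<lambda>x. P x + Q x)"
  unfolding left_finite_def
proof (intro allI)
  fix c assume "\<forall>c. finite {a. a \<le> c \<and> P a \<noteq> 0}" "\<forall>c. finite {a. a \<le> c \<and> Q a \<noteq> 0}"
  then have "finite ({a. a \<le> c \<and> P a \<noteq> 0} \<union> {a. a \<le> c \<and> Q a \<noteq> 0})" by blast
  then show "finite {a. a \<le> c \<and> P a + Q a \<noteq> 0}" by (rule finite_subset[rotated]) auto
qed

lemma left_finite_uminus: "left_finite P \<Longrightarrow> left_finite (\<lambda>x. - P x)"
  by (simp add: left_finite_def)

lemma left_finite_restrict: "left_finite P \<Longrightarrow> left_finite (\<lambda>x. if x \<in> A then P x else 0)"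
  unfolding left_finite_def by (auto intro: rev_finite_subset)

lemma finite_support_imp_left_finite: "finite {a. P a \<noteq> 0} \<Longrightarrow> left_finite P"
  unfolding left_finite_def by (auto intro: rev_finite_subset)

lemma left_finite_t_power: "left_finite (t_power a)"
  by (rule finite_support_imp_left_finite) (simp add: t_power_def)

section \<open>Novikov series as left-finite functions\<close>

lemma filterlim_at_top_iff_finite_initial:
  fixes a :: "nat \<Rightarrow> real"
  shows "filterlim a at_top sequentially \<longleftrightarrow> (\<forall>c. finite {k. a k \<le> c})"
proof -
  have "filterlim a at_top sequentially \<longleftrightarrow> (\<forall>c. eventually (\<lambda>k. c < a k) sequentially)"
    by (simp add: filterlim_at_top_dense)
  also have "\<dots> \<longleftrightarrow> (\<forall>c. finite {k. a k \<le> c})"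
    by (simp add: cofinite_eq_sequentially[symmetric] eventually_cofinite not_less)
  finally show ?thesis .
qed

text \<open>
  A finite sum has finitely many exponents, yet \<open>\<Lambda>\<close> is defined by infinite sequences tending
  to infinity, as are the infinite families in \<open>LC\<close>. Enlarging the set of exponents by the natural numbers makes it infinite
  without spoiling left-finiteness, so that one injective enumeration covers all series; the
  additional terms receive the coefficient zero.
\<close>

lemma left_finite_exponents_enumeration:
  assumes "left_finite P"
  obtains f :: "nat \<Rightarrow> real" where "inj f" "filterlim f at_top sequentially"
    "{a. P a \<noteq> 0} \<subseteq> range f"
proof -
  define S where "S = {a. P a \<noteq> 0} \<union> range real"
  have "infinite (range real)" by (simp add: range_inj_infinite)
  then have inf: "infinite S" by (simp add: S_def)
  have fin: "finite {a\<in>S. a \<le> c}" for c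
  proof -
    have "{n. real n \<le> c} \<subseteq> {..nat \<lfloor>c\<rfloor>}" by (auto intro: le_nat_floor)
    then have "finite {n. real n \<le> c}" using finite_subset by blast
    then have "finite (exponents_upto c P \<union> real ` {n. real n \<le> c})" using assms by simp
    then show ?thesis by (rule finite_subset[rotated]) (auto simp: S_def exponents_upto_def)
  qed
  have "countable (\<Union>n::nat. {a\<in>S. a \<le> real n})"
    by (rule countable_UN) (auto intro: countable_finite fin)
  moreover have "S = (\<Union>n::nat. {a\<in>S. a \<le> real n})" using real_arch_simple by auto
  ultimately have "countable S" by simp
  then have bij: "bij_betw (from_nat_into S) UNIV S" using inf by (rule bij_betw_from_nat_into)
  have "finite {k. from_nat_into S k \<le> c}" for c
  proof (rule finite_imageD)
    show "finite (from_nat_into S ` {k. from_nat_into S k \<le> c})"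
      using bij by (intro finite_subset[OF _ fin[of c]]) (auto simp: bij_betw_def)
    show "inj_on (from_nat_into S) {k. from_nat_into S k \<le> c}"
      using bij by (auto simp: bij_betw_def intro: inj_on_subset)
  qed
  then show ?thesis
    using that[of "from_nat_into S"] bij
    by (auto simp: filterlim_at_top_iff_finite_initial bij_betw_def S_def)
qed

lemma \<Lambda>_eq_left_finite: "\<Lambda> = {P. left_finite P}"
proof (intro Set.set_eqI iffI)
  fix P assume "P \<in> \<Lambda>"
  then obtain n a where P: "P = (\<lambda>x. \<Sum>k | a k = x. n k)"
    and a: "filterlim a at_top sequentially" by (auto simp: \<Lambda>_def)
  have "{b. b \<le> c \<and> P b \<noteq> 0} \<subseteq> a ` {k. a k \<le> c}" for c
  proof
    fix b assume b: "b \<in> {b. b \<le> c \<and> P b \<noteq> 0}"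
    then have "{k. a k = b} \<noteq> {}" unfolding P by force
    then show "b \<in> a ` {k. a k \<le> c}" using b by auto
  qed
  then have "finite {b. b \<le> c \<and> P b \<noteq> 0}" for c
    by (rule finite_subset) (use a in \<open>simp add: filterlim_at_top_iff_finite_initial\<close>)
  then show "P \<in> {P. left_finite P}" by (simp add: left_finite_def)
next
  fix P assume "P \<in> {P. left_finite P}"
  then obtain f :: "nat \<Rightarrow> real" where f: "inj f" "filterlim f at_top sequentially" "{a. P a \<noteq> 0} \<subseteq> range f"
    using left_finite_exponents_enumeration by blast
  have "P x = (\<Sum>k | f k = x. P (f k))" for x
  proof (cases "x \<in> range f")
    case True
    then obtain k where "x = f k" by auto
    then have "{j. f j = x} = {k}" using f(1) by (auto dest: injD)
    then show ?thesis using \<open>x = f k\<close> by simp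
  next
    case False
    then have "{j. f j = x} = {}" "P x = 0" using f(3) by auto
    then show ?thesis by simp
  qed
  then have "P = (\<lambda>x. \<Sum>k | f k = x. P (f k))" by blast
  then show "P \<in> \<Lambda>" unfolding \<Lambda>_def using f(2) by blast
qed

lemma \<Lambda>\<^sub>P_eq_finite_support: "\<Lambda>\<^sub>P = {P. finite {a. P a \<noteq> 0}}"
proof (intro Set.set_eqI iffI)
  fix P assume "P \<in> \<Lambda>\<^sub>P"
  then obtain N n a where P: "P = (\<lambda>x. \<Sum>k | k < (N::nat) \<and> a k = x. n k)" by (auto simp: \<Lambda>\<^sub>P_def)
  have "{b. P b \<noteq> 0} \<subseteq> a ` {..<N}"
  proof
    fix b assume "b \<in> {b. P b \<noteq> 0}"
    then have "{k. k < N \<and> a k = b} \<noteq> {}" unfolding P by force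
    then show "b \<in> a ` {..<N}" by auto
  qed
  then show "P \<in> {P. finite {a. P a \<noteq> 0}}" using finite_subset by auto
next
  fix P :: "real \<Rightarrow> int" assume "P \<in> {P. finite {a. P a \<noteq> 0}}"
  then have "finite {a. P a \<noteq> 0}" by simp
  from finite_imp_nat_seg_image_inj_on[OF this] obtain N and f :: "nat \<Rightarrow> real"
    where f: "{a. P a \<noteq> 0} = f ` {i. i < N}" "inj_on f {i. i < N}" by auto
  have "P x = (\<Sum>k | k < N \<and> f k = x. P (f k))" for x
  proof (cases "x \<in> f ` {i. i < N}")
    case True
    then obtain k where k: "x = f k" "k < N" by auto
    then have "{j. j < N \<and> f j = x} = {k}" using f(2) by (auto dest: inj_onD)
    then show ?thesis using k by simp
  next
    case False
    then have "{j. j < N \<and> f j = x} = {}" "P x = 0" using f(1) by auto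
    then show ?thesis by simp
  qed
  then have "P = (\<lambda>x. \<Sum>k | k < N \<and> f k = x. P (f k))" by blast
  then show "P \<in> \<Lambda>\<^sub>P" unfolding \<Lambda>\<^sub>P_def by blast
qed

section \<open>Multiplication of Novikov series\<close>

lemma novikov_mult_commute: "novikov_mult P Q = novikov_mult Q P"
  unfolding novikov_mult_def
  by (rule ext, rule sum.reindex_bij_witness[of _ "\<lambda>a. x - a" "\<lambda>a. x - a" for x]) auto

lemma novikov_mult_eq_sum:
  assumes "finite A" "\<And>a. P a \<noteq> 0 \<Longrightarrow> Q (x - a) \<noteq> 0 \<Longrightarrow> a \<in> A"
  shows "novikov_mult P Q x = (\<Sum>a\<in>A. P a * Q (x - a))"
  unfolding novikov_mult_def using assms by (intro sum.mono_neutral_left) auto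

text \<open>
  Only finitely many exponents \<open>a\<close> of \<open>P\<close> contribute to the coefficient at \<open>x\<close>, because
  \<open>x - a\<close> must not fall below the lower bound \<open>d\<close> of \<open>Q\<close>. The cutoff \<open>K\<close> is left free
  so that several coefficients can be written as sums over the same index set.
\<close>

lemma novikov_mult_eq_sum_below:
  assumes "left_finite P" "vanishes_below d Q" "x - d \<le> K"
  shows "novikov_mult P Q x = (\<Sum>a\<in>exponents_upto K P. P a * Q (x - a))"
proof (rule novikov_mult_eq_sum)
  show "a \<in> exponents_upto K P" if "P a \<noteq> 0" "Q (x - a) \<noteq> 0" for a
    using that assms(3) vanishes_belowD[OF assms(2), of "x - a"] by (auto simp: exponents_upto_def)
qed (use assms in simp)

text \<open>
  Here the index sets are independent of \<open>x\<close> as long as \<open>x\<close> stays below a fixed bound; this is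
  the form that is compared with the convolution of step functions.
\<close>

lemma novikov_mult_eq_double_sum:
  assumes "left_finite P" "left_finite Q" "vanishes_below d P" "vanishes_below d Q" "x - d \<le> K"
  shows "novikov_mult P Q x
    = (\<Sum>a\<in>exponents_upto K P. \<Sum>b\<in>exponents_upto K Q. P a * Q b * (if a + b = x then 1 else 0))"
proof -
  have "P a * Q (x - a) = (\<Sum>b\<in>exponents_upto K Q. P a * Q b * (if a + b = x then 1 else 0))"
    if "a \<in> exponents_upto K P" for a
  proof -
    have "a \<ge> d" using that vanishes_belowD[OF assms(3), of a] by (auto simp: exponents_upto_def)
    then have mem: "x - a \<in> exponents_upto K Q \<longleftrightarrow> Q (x - a) \<noteq> 0" using assms(5) by (auto simp: exponents_upto_def)
    have "(\<Sum>b\<in>exponents_upto K Q. P a * Q b * (if a + b = x then 1 else 0))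
        = (\<Sum>b\<in>exponents_upto K Q. if b = x - a then P a * Q (x - a) else 0)"
      by (intro sum.cong) auto
    also have "\<dots> = P a * Q (x - a)" using mem assms(2) by (simp add: sum.delta)
    finally show ?thesis by simp
  qed
  then show ?thesis
    using novikov_mult_eq_sum_below[OF assms(1,4,5)] by simp
qed

lemma vanishes_below_novikov_mult:
  assumes "vanishes_below c P" "vanishes_below d Q"
  shows "vanishes_below (c + d) (novikov_mult P Q)"
  unfolding vanishes_below_def
proof (intro allI impI)
  fix x assume "x < c + d"
  then have "{a. P a \<noteq> 0 \<and> Q (x - a) \<noteq> 0} = {}"
    using vanishes_belowD[OF assms(1)] vanishes_belowD[OF assms(2)]
    by (smt (verit) Collect_empty_eq)
  then show "novikov_mult P Q x = 0" unfolding novikov_mult_def by (metis (no_types, lifting) sum.empty)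
qed

text \<open>
  The exponent \<open>c + d\<close> can only be reached by adding the two least possible exponents.
\<close>

lemma novikov_mult_leading_coefficient:
  assumes "vanishes_below c P" "vanishes_below d Q"
  shows "novikov_mult P Q (c + d) = P c * Q d"
proof -
  have "novikov_mult P Q (c + d) = (\<Sum>a\<in>{c}. P a * Q (c + d - a))"
  proof (rule novikov_mult_eq_sum)
    fix a assume "P a \<noteq> 0" "Q (c + d - a) \<noteq> 0"
    then have "\<not> a < c" "\<not> c + d - a < d" using assms vanishes_belowD by blast+
    then show "a \<in> {c}" by simp
  qed simp
  then show ?thesis by simp
qed

lemma novikov_mult_support:
  assumes "novikov_mult P Q x \<noteq> 0"
  obtains a b where "P a \<noteq> 0" "Q b \<noteq> 0" "x = a + b"
proof -
  have "{a. P a \<noteq> 0 \<and> Q (x - a) \<noteq> 0} \<noteq> {}"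
    using assms unfolding novikov_mult_def by (metis (no_types, lifting) sum.empty)
  then obtain a where "P a \<noteq> 0" "Q (x - a) \<noteq> 0" by auto
  then show ?thesis using that[of a "x - a"] by simp
qed

lemma left_finite_novikov_mult:
  assumes "left_finite P" "left_finite Q"
  shows "left_finite (novikov_mult P Q)"
  unfolding left_finite_def
proof
  fix c
  obtain d where d: "vanishes_below d P" "vanishes_below d Q"
    using left_finite_common_bound[OF assms] by blast
  have "{x. x \<le> c \<and> novikov_mult P Q x \<noteq> 0} \<subseteq> (\<lambda>(a,b). a + b) ` (exponents_upto (c - d) P \<times> exponents_upto (c - d) Q)"
  proof
    fix x assume x: "x \<in> {x. x \<le> c \<and> novikov_mult P Q x \<noteq> 0}"
    then obtain a b where ab: "P a \<noteq> 0" "Q b \<noteq> 0" "x = a + b" using novikov_mult_support by blast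
    then have "a \<ge> d" "b \<ge> d" using d vanishes_belowD by (meson not_le)+
    then have "(a, b) \<in> exponents_upto (c - d) P \<times> exponents_upto (c - d) Q" using x ab by (auto simp: exponents_upto_def)
    then show "x \<in> (\<lambda>(a,b). a + b) ` (exponents_upto (c - d) P \<times> exponents_upto (c - d) Q)"
      using ab(3) by (intro image_eqI[of _ _ "(a, b)"]) simp
  qed
  then show "finite {x. x \<le> c \<and> novikov_mult P Q x \<noteq> 0}"
    by (rule finite_subset) (simp add: assms)
qed

lemma finite_support_add:
  fixes P Q :: "real \<Rightarrow> int"
  assumes "finite {a. P a \<noteq> 0}" "finite {a. Q a \<noteq> 0}"
  shows "finite {a. P a + Q a \<noteq> 0}"
proof (rule finite_subset)
  show "finite ({a. P a \<noteq> 0} \<union> {a. Q a \<noteq> 0})" using assms by simp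
qed auto

lemma finite_support_novikov_mult:
  assumes "finite {a. P a \<noteq> 0}" "finite {a. Q a \<noteq> 0}"
  shows "finite {a. novikov_mult P Q a \<noteq> 0}"
proof (rule finite_subset)
  show "{a. novikov_mult P Q a \<noteq> 0} \<subseteq> (\<lambda>(a,b). a + b) ` ({a. P a \<noteq> 0} \<times> {a. Q a \<noteq> 0})"
    by (auto elim!: novikov_mult_support)
qed (use assms in auto)

text \<open>
  The formula is symmetric in \<open>P\<close> and \<open>R\<close>, the two outer factors of the triple product. Together with
  commutativity this symmetry yields associativity.
\<close>

lemma novikov_mult_triple:
  assumes "left_finite P" "left_finite Q" "left_finite R"
    and "vanishes_below d P" "vanishes_below d Q" "vanishes_below d R" "d \<le> 0" "x - 2 * d \<le> K"
  shows "novikov_mult (novikov_mult P Q) R x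
    = (\<Sum>c\<in>exponents_upto K R. \<Sum>a\<in>exponents_upto K P. R c * P a * Q (x - c - a))"
proof -
  have "vanishes_below (2 * d) (novikov_mult P Q)"
    using vanishes_below_novikov_mult[OF assms(4,5)] by simp
  then have "novikov_mult R (novikov_mult P Q) x = (\<Sum>c\<in>exponents_upto K R. R c * novikov_mult P Q (x - c))"
    using assms by (intro novikov_mult_eq_sum_below)
  also have "\<dots> = (\<Sum>c\<in>exponents_upto K R. R c * (\<Sum>a\<in>exponents_upto K P. P a * Q (x - c - a)))"
  proof (intro sum.cong refl arg_cong2[where f = "(*)"])
    fix c assume "c \<in> exponents_upto K R"
    then have "c \<ge> d" using vanishes_belowD[OF assms(6), of c] by (auto simp: exponents_upto_def)
    then show "novikov_mult P Q (x - c) = (\<Sum>a\<in>exponents_upto K P. P a * Q (x - c - a))"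
      using assms by (intro novikov_mult_eq_sum_below) auto
  qed
  finally show ?thesis
    by (simp add: novikov_mult_commute[of _ R] sum_distrib_left mult.assoc)
qed

lemma novikov_mult_assoc:
  assumes "left_finite P" "left_finite Q" "left_finite R"
  shows "novikov_mult (novikov_mult P Q) R = novikov_mult P (novikov_mult Q R)"
proof
  fix x
  obtain d1 where "vanishes_below d1 P" "vanishes_below d1 Q" "d1 \<le> 0"
    using left_finite_common_bound assms by blast
  moreover obtain d2 where "vanishes_below d2 R"
    using left_finite_imp_vanishes_below assms by blast
  ultimately obtain d where d: "vanishes_below d P" "vanishes_below d Q" "vanishes_below d R" "d \<le> 0"
    using that[of "min d1 d2"] vanishes_below_mono by (metis min.cobounded1 min.cobounded2 order_trans)
  let ?K = "x - 2 * d"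
  have "novikov_mult (novikov_mult P Q) R x
      = (\<Sum>c\<in>exponents_upto ?K R. \<Sum>a\<in>exponents_upto ?K P. R c * P a * Q (x - c - a))"
    by (rule novikov_mult_triple[OF assms d]) simp
  also have "\<dots> = (\<Sum>a\<in>exponents_upto ?K P. \<Sum>c\<in>exponents_upto ?K R. P a * R c * Q (x - a - c))"
    by (subst sum.swap) (simp add: mult.commute algebra_simps)
  also have "\<dots> = novikov_mult (novikov_mult R Q) P x"
    by (rule novikov_mult_triple[OF assms(3,2,1) d(3,2,1,4), symmetric]) simp
  finally show "novikov_mult (novikov_mult P Q) R x = novikov_mult P (novikov_mult Q R) x"
    by (metis novikov_mult_commute)
qed

lemma novikov_mult_t_power: "novikov_mult (t_power a) P x = P (x - a)"
proof -
  have "novikov_mult (t_power a) P x = (\<Sum>b\<in>{a}. t_power a b * P (x - b))"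
    by (rule novikov_mult_eq_sum) (auto simp: t_power_def split: if_splits)
  then show ?thesis by (simp add: t_power_def)
qed

lemma novikov_mult_distrib:
  assumes "left_finite P" "left_finite Q" "left_finite R"
  shows "novikov_mult (\<lambda>x. P x + Q x) R = (\<lambda>x. novikov_mult P R x + novikov_mult Q R x)"
proof
  fix x
  obtain d where d: "vanishes_below d R"
    using left_finite_imp_vanishes_below assms by blast
  let ?A = "exponents_upto (x - d) P \<union> exponents_upto (x - d) Q"
  have fin: "finite ?A" using assms by simp
  have mem: "R (x - a) \<noteq> 0 \<Longrightarrow> a \<le> x - d" for a
    using vanishes_belowD[OF d, of "x - a"] by force
  have "novikov_mult (\<lambda>x. P x + Q x) R x = (\<Sum>a\<in>?A. (P a + Q a) * R (x - a))"
    using mem fin by (intro novikov_mult_eq_sum) (auto simp: exponents_upto_def)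
  moreover have "novikov_mult P R x = (\<Sum>a\<in>?A. P a * R (x - a))"
    using mem fin by (intro novikov_mult_eq_sum) (auto simp: exponents_upto_def)
  moreover have "novikov_mult Q R x = (\<Sum>a\<in>?A. Q a * R (x - a))"
    using mem fin by (intro novikov_mult_eq_sum) (auto simp: exponents_upto_def)
  ultimately show "novikov_mult (\<lambda>x. P x + Q x) R x = novikov_mult P R x + novikov_mult Q R x"
    by (simp add: distrib_right sum.distrib)
qed

section \<open>The Novikov ring and its finite sums\<close>

lemma Novikov_ring_simps [simp]:
  "carrier Novikov_ring = {P. left_finite P}"
  "monoid.mult Novikov_ring = novikov_mult"
  "monoid.one Novikov_ring = t_power 0"
  "ring.zero Novikov_ring = (\<lambda>_. 0)"
  "ring.add Novikov_ring = (\<lambda>P Q x. P x + Q x)"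
  by (simp_all add: Novikov_ring_def \<Lambda>_eq_left_finite)

theorem Novikov_ring_cring: "cring Novikov_ring"
proof (rule cringI)
  show "abelian_group Novikov_ring"
  proof (rule abelian_groupI)
    fix P assume "P \<in> carrier Novikov_ring"
    then show "\<exists>Q\<in>carrier Novikov_ring. Q \<oplus>\<^bsub>Novikov_ring\<^esub> P = \<zero>\<^bsub>Novikov_ring\<^esub>"
      by (intro bexI[of _ "\<lambda>x. - P x"]) (auto simp: left_finite_uminus)
  qed (auto simp: left_finite_add left_finite_zero add_ac)
  show "comm_monoid Novikov_ring"
    by (rule comm_monoidI)
       (auto simp: left_finite_novikov_mult left_finite_t_power novikov_mult_assoc
          novikov_mult_t_power intro: novikov_mult_commute)
qed (simp add: novikov_mult_distrib)

interpretation Nov: cring Novikov_ring by (rule Novikov_ring_cring)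

lemma Novikov_a_inv:
  assumes "left_finite P"
  shows "\<ominus>\<^bsub>Novikov_ring\<^esub> P = (\<lambda>x. - P x)"
  by (rule Nov.minus_equality) (use assms in \<open>auto simp: left_finite_uminus\<close>)

lemma \<Lambda>\<^sub>P_subring: "subring \<Lambda>\<^sub>P Novikov_ring"
proof (rule Nov.subringI)
  show "\<Lambda>\<^sub>P \<subseteq> carrier Novikov_ring"
    by (auto simp: \<Lambda>\<^sub>P_eq_finite_support finite_support_imp_left_finite)
  show "\<one>\<^bsub>Novikov_ring\<^esub> \<in> \<Lambda>\<^sub>P" by (simp add: \<Lambda>\<^sub>P_eq_finite_support t_power_def)
next
  fix P assume "P \<in> \<Lambda>\<^sub>P"
  then show "\<ominus>\<^bsub>Novikov_ring\<^esub> P \<in> \<Lambda>\<^sub>P"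
    by (simp add: \<Lambda>\<^sub>P_eq_finite_support Novikov_a_inv finite_support_imp_left_finite)
next
  fix P Q assume PQ: "P \<in> \<Lambda>\<^sub>P" "Q \<in> \<Lambda>\<^sub>P"
  then show "P \<otimes>\<^bsub>Novikov_ring\<^esub> Q \<in> \<Lambda>\<^sub>P"
    by (simp add: \<Lambda>\<^sub>P_eq_finite_support finite_support_novikov_mult)
  show "P \<oplus>\<^bsub>Novikov_ring\<^esub> Q \<in> \<Lambda>\<^sub>P"
    using PQ by (simp add: \<Lambda>\<^sub>P_eq_finite_support finite_support_add)
qed

lemma eval_at_one_eq_sum:
  assumes "finite A" "{a. P a \<noteq> 0} \<subseteq> A"
  shows "eval_at_one P = sum P A"
  unfolding eval_at_one_def using assms by (intro sum.mono_neutral_left) auto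

text \<open>
  Evaluation at \<open>t = 1\<close> is a ring homomorphism to the integers; that is why \<open>\<Lambda>\<^sub>P\<^sub>0\<close>, its
  kernel, is an ideal.
\<close>

lemma eval_at_one_mult:
  assumes "finite {a. P a \<noteq> 0}" "finite {a. Q a \<noteq> 0}"
  shows "eval_at_one (novikov_mult P Q) = eval_at_one P * eval_at_one Q"
proof -
  let ?A = "{a. P a \<noteq> 0}" and ?B = "{a. Q a \<noteq> 0}"
  let ?S = "(\<lambda>(a,b). a + b) ` (?A \<times> ?B)"
  have fin: "finite ?S" using assms by auto
  have "eval_at_one (novikov_mult P Q) = (\<Sum>x\<in>?S. novikov_mult P Q x)"
    using fin by (rule eval_at_one_eq_sum) (auto elim!: novikov_mult_support)
  also have "\<dots> = (\<Sum>x\<in>?S. \<Sum>a\<in>?A. P a * Q (x - a))"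
    using assms by (intro sum.cong refl novikov_mult_eq_sum) auto
  also have "\<dots> = (\<Sum>a\<in>?A. \<Sum>x\<in>?S. P a * Q (x - a))" by (rule sum.swap)
  also have "\<dots> = (\<Sum>a\<in>?A. P a * sum Q ?B)"
  proof (intro sum.cong refl)
    fix a assume a: "a \<in> ?A"
    have "(\<Sum>x\<in>?S. P a * Q (x - a)) = (\<Sum>x\<in>(+) a ` ?B. P a * Q (x - a))"
    proof (rule sum.mono_neutral_right[OF fin])
      show "(+) a ` ?B \<subseteq> ?S" using a by (auto intro!: image_eqI[of _ _ "(a, _)"])
      show "\<forall>x\<in>?S - (+) a ` ?B. P a * Q (x - a) = 0"
      proof
        fix x assume "x \<in> ?S - (+) a ` ?B"
        then have "x \<noteq> a + (x - a) \<or> x - a \<notin> ?B" by blast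
        then show "P a * Q (x - a) = 0" by simp
      qed
    qed
    also have "\<dots> = (\<Sum>b\<in>?B. P a * Q b)" by (simp add: sum.reindex)
    finally show "(\<Sum>x\<in>?S. P a * Q (x - a)) = P a * sum Q ?B" by (simp add: sum_distrib_left)
  qed
  finally show ?thesis by (simp add: eval_at_one_def sum_distrib_right)
qed

lemma eval_at_one_add:
  assumes "finite {a. P a \<noteq> 0}" "finite {a. Q a \<noteq> 0}"
  shows "eval_at_one (\<lambda>x. P x + Q x) = eval_at_one P + eval_at_one Q"
proof -
  let ?A = "{a. P a \<noteq> 0} \<union> {a. Q a \<noteq> 0}"
  have fin: "finite ?A" using assms by simp
  have "eval_at_one (\<lambda>x. P x + Q x) = (\<Sum>x\<in>?A. P x + Q x)"
    "eval_at_one P = sum P ?A" "eval_at_one Q = sum Q ?A"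
    by (rule eval_at_one_eq_sum[OF fin]; auto)+
  then show ?thesis by (simp add: sum.distrib)
qed

lemma \<Lambda>\<^sub>P_cring: "cring (Novikov_ring\<lparr>carrier := \<Lambda>\<^sub>P\<rparr>)"
  using Nov.subcring_iff Nov.subcringI'[OF \<Lambda>\<^sub>P_subring] subringE(1)[OF \<Lambda>\<^sub>P_subring] by blast

lemma \<Lambda>\<^sub>P\<^sub>0_ideal: "ideal \<Lambda>\<^sub>P\<^sub>0 (Novikov_ring\<lparr>carrier := \<Lambda>\<^sub>P\<rparr>)"
proof -
  interpret R: cring "Novikov_ring\<lparr>carrier := \<Lambda>\<^sub>P\<rparr>" by (rule \<Lambda>\<^sub>P_cring)
  have "eval_at_one (t_power 0) = 1"
    by (subst eval_at_one_eq_sum[of "{0}"]) (auto simp: t_power_def)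
  then have "eval_at_one \<in> ring_hom (Novikov_ring\<lparr>carrier := \<Lambda>\<^sub>P\<rparr>) \<Z>"
    by (intro ring_hom_memI) (auto simp: \<Lambda>\<^sub>P_eq_finite_support eval_at_one_mult eval_at_one_add)
  then have "ring_hom_ring (Novikov_ring\<lparr>carrier := \<Lambda>\<^sub>P\<rparr>) \<Z> eval_at_one"
    by (intro ring_hom_ringI2 R.ring_axioms int.ring_axioms)
  from ring_hom_ring.kernel_is_ideal[OF this] show ?thesis
    by (simp add: a_kernel_def' \<Lambda>\<^sub>P\<^sub>0_def)
qed

section \<open>Endomorphisms fixing the powers of t\<close>

text \<open>
  Multiplication by a series of valuation at least \<open>e\<close> is a contraction when \<open>e > 0\<close>: if two series agree
  below \<open>c\<close>, their multiples agree below \<open>c + e\<close>.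
\<close>

lemma novikov_mult_local:
  assumes "vanishes_below e P" "\<And>y. y < c \<Longrightarrow> Q y = R y" "x < c + e"
  shows "novikov_mult P Q x = novikov_mult P R x"
proof -
  have "Q (x - a) = R (x - a)" if "P a \<noteq> 0" for a
  proof -
    have "\<not> a < e" using that assms(1) vanishes_belowD by blast
    then show ?thesis using assms(2,3) by simp
  qed
  then have "(P a \<noteq> 0 \<and> Q (x - a) \<noteq> 0) = (P a \<noteq> 0 \<and> R (x - a) \<noteq> 0)"
    "P a * Q (x - a) = P a * R (x - a)" for a by (cases "P a = 0"; simp)+
  then show ?thesis by (simp only: novikov_mult_def)
qed

text \<open>
  The inverse \<open>U\<close> of \<open>1 + G\<close> is the fixed point of \<open>W \<mapsto> 1 - G W\<close>. This map is a
  contraction because \<open>G\<close> has positive valuation; iterating it from zero gives the partial sums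
  of the geometric series, which stabilize on every half-line bounded above.
\<close>

lemma novikov_one_plus_positive_unit:
  assumes G: "left_finite G" "vanishes_below e G" and e: "e > 0"
  obtains U where "left_finite U" "novikov_mult (\<lambda>x. t_power 0 x + G x) U = t_power 0"
proof -
  define V where "V n = ((\<lambda>W x. t_power 0 x - novikov_mult G W x) ^^ n) (\<lambda>_. 0)" for n
  have V_Suc: "V (Suc n) = (\<lambda>x. t_power 0 x - novikov_mult G (V n) x)" for n
    by (simp add: V_def)
  have V_lf: "left_finite (V n)" for n
  proof (induction n)
    case 0
    show ?case by (simp add: V_def left_finite_zero)
  next
    case (Suc n)
    then have "left_finite (\<lambda>x. t_power 0 x + (- novikov_mult G (V n) x))"
      using G by (intro left_finite_add left_finite_uminus left_finite_novikov_mult left_finite_t_power)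
    then show ?case by (simp add: V_Suc)
  qed
  have step: "x < real n * e \<Longrightarrow> V (Suc n) x = V n x" for n x
  proof (induction n arbitrary: x)
    case 0
    have "G a = 0 \<or> V 0 (x - a) = 0" for a by (simp add: V_def)
    then have "novikov_mult G (V 0) x = 0" by (simp add: novikov_mult_def V_def)
    then show ?case using 0 by (simp add: V_Suc V_def t_power_def)
  next
    case (Suc n)
    have "x < real n * e + e" using Suc.prems by (simp add: distrib_right)
    then have "novikov_mult G (V (Suc n)) x = novikov_mult G (V n) x"
      by (rule novikov_mult_local[OF G(2) Suc.IH, rotated])
    then show ?case using V_Suc by metis
  qed
  have stable: "V n x = V m x" if "m \<le> n" "x < real m * e" for m n x
    using that(1)
  proof (induction n rule: dec_induct)
    case (step n)
    have "real m * e \<le> real n * e" using step.hyps e by simp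
    then have "V (Suc n) x = V n x" using \<open>x < real m * e\<close> by (intro \<open>\<And>x n. x < real n * e \<Longrightarrow> V (Suc n) x = V n x\<close>) simp
    then show ?case using step by simp
  qed simp
  define N where "N x = (LEAST n. x < real n * e)" for x
  have N: "x < real (N x) * e" for x
    unfolding N_def using ex_less_of_nat_mult[OF e] by (rule LeastI_ex)
  define U where "U x = V (N x) x" for x
  have U: "U x = V n x" if "x < real n * e" for x n
    unfolding U_def by (rule stable[OF _ N, symmetric]) (simp add: N_def Least_le that)
  have U_lf: "left_finite U"
    unfolding left_finite_def
  proof
    fix c
    obtain n where n: "c < real n * e" using ex_less_of_nat_mult[OF e] by blast
    have "U a = V n a" if "a \<le> c" for a using that n by (intro U) simp
    then have "{a. a \<le> c \<and> U a \<noteq> 0} = exponents_upto c (V n)" unfolding exponents_upto_def by auto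
    then show "finite {a. a \<le> c \<and> U a \<noteq> 0}" using V_lf by simp
  qed
  have fix_U: "U x = t_power 0 x - novikov_mult G U x" for x
  proof -
    obtain n where n: "x < real n * e" using ex_less_of_nat_mult[OF e] by blast
    have "novikov_mult G U x = novikov_mult G (V n) x"
      by (rule novikov_mult_local[OF G(2), of "real n * e"]) (use n e U in simp_all)
    moreover have "U x = V (Suc n) x" using n e by (intro U) (simp add: algebra_simps)
    ultimately show ?thesis by (simp add: V_Suc)
  qed
  have "novikov_mult (\<lambda>x. t_power 0 x + G x) U = (\<lambda>x. U x + novikov_mult G U x)"
    using G U_lf by (simp add: novikov_mult_distrib left_finite_t_power novikov_mult_t_power)
  also have "\<dots> = t_power 0" by (subst fix_U) simp
  finally show ?thesis using that U_lf by blast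
qed

text \<open>
  The leading coefficient of a product is the product of the leading coefficients, so the leading
  coefficient of a unit is invertible in the integers.
\<close>

lemma novikov_unit_leading_coefficient:
  assumes "left_finite P" "left_finite Q" "novikov_mult P Q = t_power 0"
    and "vanishes_below s P" "P s \<noteq> 0"
  shows "P s dvd 1"
proof -
  have "novikov_mult P Q 0 \<noteq> 0" using assms(3) by (simp add: t_power_def)
  then obtain a where "Q a \<noteq> 0" by (rule novikov_mult_support)
  then obtain d where d: "Q d \<noteq> 0" "vanishes_below d Q"
    using left_finite_least_exponent assms(2) by metis
  have "t_power 0 (s + d) = P s * Q d"
    using novikov_mult_leading_coefficient[OF assms(4) d(2)] assms(3) by simp
  then have "P s * Q d = 1" using assms(5) d(1) by (auto simp: t_power_def split: if_splits)
  then show ?thesis by (metis dvd_triv_left)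
qed

text \<open>
  A ring homomorphism need not respect infinite sums, so fixing the powers of \<open>t\<close> determines
  \<open>\<psi>\<close> at first only on finite sums.
\<close>

locale Novikov_endomorphism =
  fixes \<psi> :: "(real \<Rightarrow> int) \<Rightarrow> real \<Rightarrow> int"
  assumes hom: "\<psi> \<in> ring_hom Novikov_ring Novikov_ring"
    and t_power: "\<psi> (t_power a) = t_power a"
begin

lemma left_finite_image: "left_finite P \<Longrightarrow> left_finite (\<psi> P)"
  using ring_hom_memE(1)[OF hom] by simp

lemma mult: "left_finite P \<Longrightarrow> left_finite Q \<Longrightarrow> \<psi> (novikov_mult P Q) = novikov_mult (\<psi> P) (\<psi> Q)"
  using ring_hom_memE(2)[OF hom] by simp

lemma add: "left_finite P \<Longrightarrow> left_finite Q \<Longrightarrow> \<psi> (\<lambda>x. P x + Q x) = (\<lambda>x. \<psi> P x + \<psi> Q x)"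
  using ring_hom_memE(3)[OF hom] by simp

lemma zero: "\<psi> (\<lambda>_. 0) = (\<lambda>_. 0)"
  using ring_hom_zero[OF hom Nov.ring_axioms Nov.ring_axioms] by simp

text \<open>
  An algebraic description of the valuation makes \<open>\<psi>\<close> automatically continuous. Suppose the
  least exponent \<open>s\<close> of \<open>\<psi> f\<close> were smaller than \<open>c\<close>. For \<open>a\<close> between \<open>-c\<close> and \<open>-s\<close> the
  series \<open>1 + 2 t\<^sup>a f\<close> is a unit, since \<open>t\<^sup>a f\<close> has positive valuation. Hence its
  image \<open>1 + 2 t\<^sup>a \<psi> f\<close> is a unit as well. But this image has the negative least exponent
  \<open>s + a\<close>, and its leading coefficient there is even.
\<close>

lemma vanishes_below_image:
  assumes f: "left_finite f" "vanishes_below c f"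
  shows "vanishes_below c (\<psi> f)"
proof (rule ccontr)
  assume "\<not> vanishes_below c (\<psi> f)"
  then obtain x where "x < c" "\<psi> f x \<noteq> 0" by (auto simp: vanishes_below_def)
  then obtain s where s: "\<psi> f s \<noteq> 0" "vanishes_below s (\<psi> f)" "s < c"
    using left_finite_least_exponent[OF left_finite_image[OF f(1)]] by (metis le_less_trans)
  \<comment> \<open>the midpoint of the admissible range from \<open>-c\<close> to \<open>-s\<close>\<close>
  define a where "a = - (s + c) / 2"
  have a: "s + a < 0" "c + a > 0" using s(3) by (auto simp: a_def field_simps)
  let ?g = "\<lambda>x. f x + f x"
  let ?G = "novikov_mult (t_power a) ?g"
  have g: "left_finite ?g" using f by (intro left_finite_add)
  then have G: "left_finite ?G" by (intro left_finite_novikov_mult left_finite_t_power)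
  have "vanishes_below (c + a) ?G"
    using f(2) by (simp add: vanishes_below_def novikov_mult_t_power)
  from novikov_one_plus_positive_unit[OF G this a(2)]
  obtain U where U: "left_finite U" "novikov_mult (\<lambda>x. t_power 0 x + ?G x) U = t_power 0" by blast
  let ?H = "\<lambda>x. t_power 0 x + 2 * \<psi> f (x - a)"
  have G1: "left_finite (\<lambda>x. t_power 0 x + ?G x)"
    using G by (intro left_finite_add left_finite_t_power)
  have H: "\<psi> (\<lambda>x. t_power 0 x + ?G x) = ?H"
  proof -
    have "\<psi> (\<lambda>x. t_power 0 x + ?G x) = (\<lambda>x. \<psi> (t_power 0) x + \<psi> ?G x)"
      by (rule add[OF left_finite_t_power G])
    also have "\<psi> ?G = novikov_mult (\<psi> (t_power a)) (\<psi> ?g)"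
      by (rule mult[OF left_finite_t_power g])
    also have "\<psi> ?g = (\<lambda>x. \<psi> f x + \<psi> f x)" by (rule add[OF f(1) f(1)])
    finally show ?thesis by (simp add: t_power novikov_mult_t_power)
  qed
  have "novikov_mult ?H (\<psi> U) = t_power 0"
    using mult[OF G1 U(1)] H U(2) t_power by metis
  moreover have "left_finite ?H" using left_finite_image[OF G1] H by simp
  moreover have "vanishes_below (s + a) ?H"
    using s(2) a(1) by (auto simp: vanishes_below_def t_power_def)
  moreover have "?H (s + a) = 2 * \<psi> f s" using a(1) by (simp add: t_power_def)
  ultimately have "2 * \<psi> f s dvd 1"
    using novikov_unit_leading_coefficient[of ?H "\<psi> U" "s + a"] left_finite_image[OF U(1)] s(1) by simp
  then show False by (meson dvd_mult_left odd_one)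
qed

lemma fixes_monomials: "\<psi> (\<lambda>x. n * t_power a x) = (\<lambda>x. n * t_power a x)"
proof -
  have lf: "left_finite (\<lambda>x. k * t_power a x)" for k
    by (rule finite_support_imp_left_finite) (simp add: t_power_def)
  have suc: "\<psi> (\<lambda>x. (k + 1) * t_power a x) = (\<lambda>x. \<psi> (\<lambda>x. k * t_power a x) x + t_power a x)" for k
    using add[OF lf left_finite_t_power, of k a] by (simp add: t_power distrib_right)
  show ?thesis
  proof (induction n rule: int_induct[where k = 0])
    case base
    then show ?case by (simp add: zero)
  next
    case (step1 i)
    then show ?case by (simp only: suc) (simp add: distrib_right)
  next
    case (step2 i)
    have "i - 1 + 1 = i" by simp
    then have "(\<lambda>x. i * t_power a x) = (\<lambda>x. \<psi> (\<lambda>x. (i - 1) * t_power a x) x + t_power a x)"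
      using suc[of "i - 1"] step2 by metis
    then have eq: "i * t_power a x = \<psi> (\<lambda>x. (i - 1) * t_power a x) x + t_power a x" for x
      by (rule fun_cong)
    show ?case
    proof
      fix x
      show "\<psi> (\<lambda>x. (i - 1) * t_power a x) x = (i - 1) * t_power a x"
        using eq[of x] by (simp add: left_diff_distrib)
    qed
  qed
qed

lemma fixes_\<Lambda>\<^sub>P:
  assumes "P \<in> \<Lambda>\<^sub>P"
  shows "\<psi> P = P"
proof -
  obtain N n a where P: "P = (\<lambda>x. \<Sum>k | k < (N::nat) \<and> a k = x. n k)"
    using assms by (auto simp: \<Lambda>\<^sub>P_def)
  define S where "S M = (\<lambda>x. \<Sum>k | k < (M::nat) \<and> a k = x. n k)" for M
  have "S M \<in> \<Lambda>\<^sub>P" for M unfolding \<Lambda>\<^sub>P_def S_def by blast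
  then have lf: "left_finite (S M)" for M
    by (simp add: \<Lambda>\<^sub>P_eq_finite_support finite_support_imp_left_finite)
  have Suc_S: "S (Suc M) = (\<lambda>x. S M x + n M * t_power (a M) x)" for M
  proof
    fix x
    have "{k. k < Suc M \<and> a k = x} = (if a M = x then insert M {k. k < M \<and> a k = x} else {k. k < M \<and> a k = x})"
      by (auto simp: less_Suc_eq)
    then show "S (Suc M) x = S M x + n M * t_power (a M) x"
      by (simp add: S_def t_power_def)
  qed
  have "\<psi> (S M) = S M" for M
  proof (induction M)
    case 0
    then show ?case by (simp add: S_def zero)
  next
    case (Suc M)
    have "left_finite (\<lambda>x. n M * t_power (a M) x)"
      by (rule finite_support_imp_left_finite) (simp add: t_power_def)
    then have "\<psi> (S (Suc M)) = (\<lambda>x. \<psi> (S M) x + \<psi> (\<lambda>x. n M * t_power (a M) x) x)"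
      unfolding Suc_S[of M] by (rule add[OF lf])
    also have "\<dots> = S (Suc M)" unfolding Suc.IH fixes_monomials Suc_S[of M] ..
    finally show ?case .
  qed
  moreover have "P = S N" by (simp add: P S_def)
  ultimately show ?thesis by simp
qed

text \<open>
  Cutting \<open>f\<close> just above \<open>x\<close> leaves a finite sum, which is fixed, and a remainder whose image
  still does not reach \<open>x\<close>.
\<close>

theorem identity:
  assumes f: "left_finite f"
  shows "\<psi> f = f"
proof
  fix x
  define P where "P y = (if y \<in> {..<x + 1} then f y else 0)" for y
  define R where "R y = (if y \<in> {x + 1..} then f y else 0)" for y
  have R: "left_finite R" unfolding R_def by (rule left_finite_restrict[OF f])
  have R': "vanishes_below (x + 1) R" by (simp add: R_def vanishes_below_def)
  have "{y. P y \<noteq> 0} \<subseteq> exponents_upto (x + 1) f" by (auto simp: P_def exponents_upto_def)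
  then have "finite {y. P y \<noteq> 0}" using f finite_exponents_upto finite_subset by blast
  then have P: "left_finite P" "\<psi> P = P"
    using fixes_\<Lambda>\<^sub>P by (auto simp: \<Lambda>\<^sub>P_eq_finite_support finite_support_imp_left_finite)
  have "f = (\<lambda>y. P y + R y)" by (auto simp: P_def R_def)
  then have "\<psi> f x = P x + \<psi> R x" using add[OF P(1) R] P(2) by simp
  also have "\<psi> R x = 0" using vanishes_belowD[OF vanishes_below_image[OF R R']] by simp
  finally show "\<psi> f x = f x" by (simp add: P_def)
qed

end

section \<open>The step function of a Novikov series\<close>

text \<open>
  This is \<open>\<theta>\<close>: the coefficient of \<open>t\<^sup>a\<close> is the height of the jump at \<open>a\<close>.
\<close>

definition step_of :: "(real \<Rightarrow> int) \<Rightarrow> real \<Rightarrow> real" where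
  "step_of P x = of_int (\<Sum>a\<in>exponents_upto x P. P a)"

lemma step_of_eq_sum:
  assumes "finite A" "\<And>a. a \<le> x \<Longrightarrow> P a \<noteq> 0 \<Longrightarrow> a \<in> A"
  shows "step_of P x = (\<Sum>a\<in>A. of_int (P a) * indicat_real {a..} x)"
proof -
  have "(\<Sum>a\<in>A. of_int (P a) * indicat_real {a..} x) = (\<Sum>a\<in>exponents_upto x P. of_int (P a) * indicat_real {a..} x)"
    using assms by (intro sum.mono_neutral_right) (auto simp: exponents_upto_def indicator_def)
  also have "\<dots> = (\<Sum>a\<in>exponents_upto x P. of_int (P a))"
    by (intro sum.cong) (auto simp: exponents_upto_def indicator_def)
  finally show ?thesis by (simp add: step_of_def)
qed

text \<open>
  On a half-line bounded above, \<open>step_of P\<close> is a finite sum of indicators with a fixed index set.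
  Convolutions and pairings with test functions are computed after this reduction.
\<close>

lemma step_of_eq_sum_below:
  assumes "left_finite P" "x \<le> K"
  shows "step_of P x = (\<Sum>a\<in>exponents_upto K P. of_int (P a) * indicat_real {a..} x)"
proof (rule step_of_eq_sum)
  show "finite (exponents_upto K P)" using assms by simp
qed (use assms in \<open>simp add: exponents_upto_def\<close>)

lemma step_of_vanishes: "vanishes_below d P \<Longrightarrow> x < d \<Longrightarrow> step_of P x = 0"
  by (auto simp: step_of_def exponents_upto_def vanishes_below_def intro!: sum.neutral)

lemma step_of_t_power: "step_of (t_power a) = indicat_real {a..}"
proof
  fix x show "step_of (t_power a) x = indicat_real {a..} x"
    by (subst step_of_eq_sum[of "{a}"]) (auto simp: t_power_def split: if_splits)
qed

lemma step_of_zero: "step_of (\<lambda>_. 0) = (\<lambda>_. 0)"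
  by (simp add: step_of_def fun_eq_iff)

lemma step_of_add:
  assumes "left_finite P" "left_finite Q"
  shows "step_of (\<lambda>a. P a + Q a) x = step_of P x + step_of Q x"
proof -
  let ?A = "exponents_upto x P \<union> exponents_upto x Q"
  have fin: "finite ?A" using assms by simp
  have "step_of (\<lambda>a. P a + Q a) x = (\<Sum>a\<in>?A. of_int (P a + Q a) * indicat_real {a..} x)"
    by (rule step_of_eq_sum[OF fin]) (auto simp: exponents_upto_def)
  moreover have "step_of P x = (\<Sum>a\<in>?A. of_int (P a) * indicat_real {a..} x)"
    by (rule step_of_eq_sum[OF fin]) (auto simp: exponents_upto_def)
  moreover have "step_of Q x = (\<Sum>a\<in>?A. of_int (Q a) * indicat_real {a..} x)"
    by (rule step_of_eq_sum[OF fin]) (auto simp: exponents_upto_def)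
  ultimately show ?thesis by (simp add: distrib_right sum.distrib)
qed

lemma step_of_least_exponent:
  assumes "vanishes_below s P" "P s \<noteq> 0"
  shows "step_of P s = of_int (P s)"
proof -
  have "\<not> a < s" if "P a \<noteq> 0" for a using that assms(1) vanishes_belowD by blast
  then have "exponents_upto s P = {s}" using assms(2) by (force simp: exponents_upto_def)
  then show ?thesis by (simp add: step_of_def)
qed

text \<open>
  Both injectivity statements, for \<open>step_of\<close> itself and for the distributions it defines, look
  at the first exponent at which two series differ.
\<close>

lemma least_exponent_of_difference:
  assumes "left_finite P" "left_finite Q" "P \<noteq> Q"
  obtains R s where "left_finite R" "P = (\<lambda>a. Q a + R a)" "R s \<noteq> 0" "vanishes_below s R"
proof -
  let ?R = "\<lambda>a. P a + - Q a"
  have R: "left_finite ?R" using assms by (intro left_finite_add left_finite_uminus)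
  obtain a where "?R a \<noteq> 0" using assms(3) by force
  then obtain s where s: "?R s \<noteq> 0" "vanishes_below s ?R"
    by (rule left_finite_least_exponent[OF R])
  show ?thesis by (rule that[OF R _ s]) auto
qed

lemma step_of_inj: "inj_on step_of {P. left_finite P}"
proof (rule inj_onI, rule ccontr)
  fix P Q assume PQ: "P \<in> {P. left_finite P}" "Q \<in> {P. left_finite P}" "step_of P = step_of Q" "P \<noteq> Q"
  then obtain R s where R: "left_finite R" "P = (\<lambda>a. Q a + R a)" "R s \<noteq> 0" "vanishes_below s R"
    using least_exponent_of_difference[of P Q] by blast
  have "step_of P s = step_of Q s + of_int (R s)"
    using PQ R step_of_add[of Q R s] step_of_least_exponent[of s R] by simp
  then show False using R(3) PQ(3) by simp
qed

section \<open>Test functions and the derivative of a ramp\<close>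

lemma test_function_DERIV:
  assumes "\<phi> \<in> test_functions"
  shows "DERIV \<phi> x :> deriv \<phi> x"
proof -
  have "(deriv ^^ 0) \<phi> differentiable at x" using assms unfolding test_functions_def by blast
  then show ?thesis by (simp add: DERIV_deriv_iff_real_differentiable)
qed

lemma test_function_isCont: "\<phi> \<in> test_functions \<Longrightarrow> isCont \<phi> x"
  using test_function_DERIV DERIV_isCont by blast

text \<open>
  An upper bound suffices, because test functions are only integrated against functions that
  vanish near \<open>-\<infinity>\<close>.
\<close>

lemma test_function_bound:
  assumes "\<phi> \<in> test_functions"
  obtains M where "\<And>x. x > M \<Longrightarrow> \<phi> x = 0"
proof -
  have "bounded {x. \<phi> x \<noteq> 0}"
    using assms by (auto simp: test_functions_def intro: bounded_subset[OF compact_imp_bounded closure_subset])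
  then obtain M where "\<And>x. \<phi> x \<noteq> 0 \<Longrightarrow> \<bar>x\<bar> \<le> M" by (auto simp: bounded_iff)
  then show ?thesis using that[of M] by (metis abs_ge_self leD order_trans)
qed

lemma test_function_deriv:
  assumes "\<phi> \<in> test_functions"
  shows "deriv \<phi> \<in> test_functions"
proof -
  let ?S = "closure {x. \<phi> x \<noteq> 0}"
  have "deriv \<phi> x = 0" if "x \<notin> ?S" for x
  proof -
    have "eventually (\<lambda>y. y \<in> - ?S) (nhds x)"
      using that by (intro eventually_nhds_in_open) auto
    then have "eventually (\<lambda>y. \<phi> y = 0) (nhds x)"
      by eventually_elim (use closure_subset in force)
    then have "deriv \<phi> x = deriv (\<lambda>_. 0) x" by (intro deriv_cong_ev) auto
    then show ?thesis by simp
  qed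
  then have "closure {x. deriv \<phi> x \<noteq> 0} \<subseteq> ?S" by (intro closure_minimal) auto
  then have "compact (closure {x. deriv \<phi> x \<noteq> 0})"
    using assms by (auto simp: test_functions_def compact_eq_bounded_closed intro: bounded_subset)
  moreover have "(deriv ^^ n) (deriv \<phi>) differentiable at x" for n x
  proof -
    have "(deriv ^^ Suc n) \<phi> differentiable at x" using assms unfolding test_functions_def by blast
    then show ?thesis by (simp add: funpow_swap1)
  qed
  ultimately show ?thesis by (simp add: test_functions_def)
qed

lemma integrable_lebesgue_Icc:
  fixes f :: "real \<Rightarrow> real"
  assumes "\<And>x. isCont f x"
  shows "integrable lebesgue (\<lambda>x. f x * indicat_real {a..b} x)"
    and "(LINT x|lebesgue. f x * indicat_real {a..b} x) = (LINT x|lborel. f x * indicat_real {a..b} x)"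
proof -
  have int: "integrable lborel (\<lambda>x. f x * indicat_real {a..b} x)"
    using assms by (intro borel_integrable_atLeastAtMost)
  then show "integrable lebesgue (\<lambda>x. f x * indicat_real {a..b} x)"
    by (simp add: integrable_completion)
  show "(LINT x|lebesgue. f x * indicat_real {a..b} x) = (LINT x|lborel. f x * indicat_real {a..b} x)"
    using int by (intro integral_completion) auto
qed

lemma integrable_indicator_test_function:
  assumes "\<phi> \<in> test_functions"
  shows "integrable lebesgue (\<lambda>x. indicat_real {s..} x * \<phi> x)"
proof -
  obtain M where M: "\<And>x. x > M \<Longrightarrow> \<phi> x = 0" using test_function_bound[OF assms] by blast
  have "(\<lambda>x. indicat_real {s..} x * \<phi> x) = (\<lambda>x. \<phi> x * indicat_real {s..M} x)"
    using M by (force simp: indicator_def)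
  then show ?thesis using integrable_lebesgue_Icc(1)[OF test_function_isCont[OF assms]] by simp
qed

text \<open>
  The distributional derivative of the ramp \<open>x \<mapsto> max 0 (x - s)\<close> is the indicator of \<open>[s, \<infinity>)\<close>.
  This is integration by parts for \<open>(x - s) \<phi> x\<close>, whose boundary terms vanish at \<open>s\<close> and beyond the
  support of \<open>\<phi>\<close>.
\<close>

lemma ramp_derivative:
  assumes \<phi>: "\<phi> \<in> test_functions"
  shows "integrable lebesgue (\<lambda>x. max 0 (x - s) * deriv \<phi> x)"
    and "(LINT x|lebesgue. max 0 (x - s) * deriv \<phi> x) = - (LINT x|lebesgue. indicat_real {s..} x * \<phi> x)"
proof -
  note \<phi>' = test_function_deriv[OF \<phi>]
  obtain M1 where M1: "\<And>x. x > M1 \<Longrightarrow> \<phi> x = 0" using test_function_bound[OF \<phi>] by blast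
  obtain M2 where M2: "\<And>x. x > M2 \<Longrightarrow> deriv \<phi> x = 0" using test_function_bound[OF \<phi>'] by blast
  \<comment> \<open>the summand \<open>1\<close> makes \<open>\<phi>\<close> and its derivative vanish at \<open>M\<close> itself, not only beyond it\<close>
  define M where "M = max s (max M1 M2) + 1"
  have M: "s \<le> M" "x \<ge> M \<Longrightarrow> \<phi> x = 0" "x \<ge> M \<Longrightarrow> deriv \<phi> x = 0" for x
    using M1 M2 by (auto simp: M_def)
  have cont: "isCont \<phi> x" "isCont (\<lambda>x. (x - s) * deriv \<phi> x) x" for x
    using test_function_isCont[OF \<phi>] test_function_isCont[OF \<phi>'] by (auto intro!: continuous_intros)
  have e1: "(\<lambda>x. max 0 (x - s) * deriv \<phi> x) = (\<lambda>x. ((x - s) * deriv \<phi> x) * indicat_real {s..M} x)"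
    using M by (auto simp: indicator_def fun_eq_iff max_def)
  have e2: "(\<lambda>x. indicat_real {s..} x * \<phi> x) = (\<lambda>x. \<phi> x * indicat_real {s..M} x)"
    using M by (auto simp: indicator_def fun_eq_iff)
  note int = integrable_lebesgue_Icc[OF cont(1), of s M] integrable_lebesgue_Icc[OF cont(2), of s M]
  show "integrable lebesgue (\<lambda>x. max 0 (x - s) * deriv \<phi> x)" unfolding e1 by (rule int)
  have "(LINT x|lborel. (\<phi> x + (x - s) * deriv \<phi> x) * indicat_real {s..M} x) = (M - s) * \<phi> M - (s - s) * \<phi> s"
  proof (rule integral_FTC_Icc_real[OF M(1)])
    show "DERIV (\<lambda>x. (x - s) * \<phi> x) x :> \<phi> x + (x - s) * deriv \<phi> x" for x
      by (auto intro!: derivative_eq_intros test_function_DERIV[OF \<phi>] simp: algebra_simps)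
    show "isCont (\<lambda>x. \<phi> x + (x - s) * deriv \<phi> x) x" for x using cont by (intro continuous_add)
  qed
  then have "(LINT x|lborel. \<phi> x * indicat_real {s..M} x + ((x - s) * deriv \<phi> x) * indicat_real {s..M} x) = 0"
    using M by (simp add: distrib_right)
  then have "(LINT x|lborel. \<phi> x * indicat_real {s..M} x)
      + (LINT x|lborel. ((x - s) * deriv \<phi> x) * indicat_real {s..M} x) = 0"
    using cont by (subst (asm) Bochner_Integration.integral_add) (auto intro!: borel_integrable_atLeastAtMost)
  then show "(LINT x|lebesgue. max 0 (x - s) * deriv \<phi> x) = - (LINT x|lebesgue. indicat_real {s..} x * \<phi> x)"
    unfolding e1 e2 int by linarith
qed

section \<open>Convolution of step functions\<close>

text \<open>
  Collecting the terms \<open>t\<^sup>a t\<^sup>b\<close> with the same exponent \<open>a + b\<close> does not change the sum of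
  indicators, so the step function of the product can be written with the pairs \<open>(a, b)\<close>.
\<close>

lemma step_of_novikov_mult:
  assumes lf: "left_finite P" "left_finite Q" and d: "vanishes_below d P" "vanishes_below d Q"
    and K: "x - d \<le> K"
  shows "step_of (novikov_mult P Q) x
    = (\<Sum>a\<in>exponents_upto K P. \<Sum>b\<in>exponents_upto K Q. of_int (P a * Q b) * indicat_real {a + b..} x)"
proof -
  let ?A = "exponents_upto K P" and ?B = "exponents_upto K Q"
  let ?T = "(\<lambda>(a, b). a + b) ` (?A \<times> ?B)"
  have fin: "finite ?T" using lf by simp
  have sub: "s \<in> ?T" if s: "s \<le> x" "novikov_mult P Q s \<noteq> 0" for s
  proof -
    obtain a b where ab: "P a \<noteq> 0" "Q b \<noteq> 0" "s = a + b" using novikov_mult_support s(2) by blast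
    then have "\<not> a < d" "\<not> b < d" using d vanishes_belowD by blast+
    then have "(a, b) \<in> ?A \<times> ?B" using s ab K by (auto simp: exponents_upto_def)
    then show ?thesis using ab(3) by (intro image_eqI[of _ _ "(a, b)"]) simp
  qed
  have "step_of (novikov_mult P Q) x = (\<Sum>s\<in>?T. of_int (novikov_mult P Q s) * indicat_real {s..} x)"
    using fin sub by (rule step_of_eq_sum)
  also have "\<dots> = (\<Sum>s\<in>?T. \<Sum>a\<in>?A. \<Sum>b\<in>?B. if s = a + b then of_int (P a * Q b) * indicat_real {a + b..} x else 0)"
  proof (intro sum.cong refl)
    fix s
    show "of_int (novikov_mult P Q s) * indicat_real {s..} x
      = (\<Sum>a\<in>?A. \<Sum>b\<in>?B. if s = a + b then of_int (P a * Q b) * indicat_real {a + b..} x else 0)"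
    proof (cases "s \<le> x")
      case True
      have "novikov_mult P Q s = (\<Sum>a\<in>?A. \<Sum>b\<in>?B. P a * Q b * (if a + b = s then 1 else 0))"
        by (rule novikov_mult_eq_double_sum[OF lf d]) (use True K in simp)
      then show ?thesis using True
        by (auto simp: of_int_sum intro!: sum.cong)
    next
      case False
      then have "(if s = a + b then of_int (P a * Q b) * indicat_real {a + b..} x else 0) = 0" for a b
        by simp
      then show ?thesis using False by (simp only: sum.neutral_const) simp
    qed
  qed
  also have "\<dots> = (\<Sum>a\<in>?A. \<Sum>s\<in>?T. \<Sum>b\<in>?B. if s = a + b then of_int (P a * Q b) * indicat_real {a + b..} x else 0)"
    by (rule sum.swap)
  also have "\<dots> = (\<Sum>a\<in>?A. \<Sum>b\<in>?B. \<Sum>s\<in>?T. if s = a + b then of_int (P a * Q b) * indicat_real {a + b..} x else 0)"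
    by (intro sum.cong refl sum.swap)
  also have "\<dots> = (\<Sum>a\<in>?A. \<Sum>b\<in>?B. of_int (P a * Q b) * indicat_real {a + b..} x)"
  proof (intro sum.cong refl)
    fix a b assume "a \<in> ?A" "b \<in> ?B"
    then have "a + b \<in> ?T" by (intro image_eqI[of _ _ "(a, b)"]) simp_all
    then show "(\<Sum>s\<in>?T. if s = a + b then of_int (P a * Q b) * indicat_real {a + b..} x else 0)
      = of_int (P a * Q b) * indicat_real {a + b..} x" using fin by (simp add: sum.delta)
  qed
  finally show ?thesis .
qed

text \<open>
  The convolution of the indicators of \<open>[a, \<infinity>)\<close> and \<open>[b, \<infinity>)\<close> at \<open>x\<close> is the length of
  \<open>[b, x - a]\<close>, that is, the ramp starting at \<open>a + b\<close>. Both factors of the integrand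
  vanish when their arguments \<open>x - y\<close> and \<open>y\<close> are too far to the left, so for given \<open>x\<close> only finitely many pairs of exponents are involved.
\<close>

lemma step_of_convolution:
  assumes lf: "left_finite P" "left_finite Q" and d: "vanishes_below d P" "vanishes_below d Q"
    and K: "x - d \<le> K"
  shows "integrable lebesgue (\<lambda>y. step_of P (x - y) * step_of Q y)"
    and "convolution (step_of P) (step_of Q) x
      = (\<Sum>a\<in>exponents_upto K P. \<Sum>b\<in>exponents_upto K Q. of_int (P a * Q b) * max 0 (x - (a + b)))"
proof -
  let ?A = "exponents_upto K P" and ?B = "exponents_upto K Q"
  have ge: "a \<in> ?A \<Longrightarrow> d \<le> a" "a \<in> ?B \<Longrightarrow> d \<le> a" for a
    using d vanishes_belowD[of d _ a] by (force simp: exponents_upto_def)+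
  have eq: "step_of P (x - y) * step_of Q y
      = (\<Sum>a\<in>?A. \<Sum>b\<in>?B. of_int (P a * Q b) * indicat_real {b..x - a} y)" for y
  proof -
    consider "y < d" | "x - y < d" | "d \<le> y" "d \<le> x - y" by linarith
    then show ?thesis
    proof cases
      case 1
      then have "indicat_real {b..x - a} y = 0" if "b \<in> ?B" for a b using ge(2)[OF that] by simp
      then show ?thesis using step_of_vanishes[OF d(2) 1] by simp
    next
      case 2
      then have "indicat_real {b..x - a} y = 0" if "a \<in> ?A" for a b using ge(1)[OF that] by simp
      then show ?thesis using step_of_vanishes[OF d(1) 2] by simp
    next
      case 3
      then have "step_of P (x - y) * step_of Q y = (\<Sum>a\<in>?A. of_int (P a) * indicat_real {a..} (x - y))
         * (\<Sum>b\<in>?B. of_int (Q b) * indicat_real {b..} y)"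
        using K step_of_eq_sum_below[OF lf(1), of "x - y" K] step_of_eq_sum_below[OF lf(2), of y K] by simp
      also have "\<dots> = (\<Sum>a\<in>?A. \<Sum>b\<in>?B. (of_int (P a) * indicat_real {a..} (x - y)) * (of_int (Q b) * indicat_real {b..} y))"
        by (rule sum_product)
      also have "\<dots> = (\<Sum>a\<in>?A. \<Sum>b\<in>?B. of_int (P a * Q b) * indicat_real {b..x - a} y)"
        by (intro sum.cong refl) (auto simp: indicator_def)
      finally show ?thesis .
    qed
  qed
  have int: "integrable lebesgue (indicat_real {b..c})" for b c :: real
    by (simp add: integrable_indicator_iff emeasure_lborel_Icc_eq)
  show "integrable lebesgue (\<lambda>y. step_of P (x - y) * step_of Q y)"
    unfolding eq using int by (intro Bochner_Integration.integrable_sum integrable_mult_right) auto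
  have "convolution (step_of P) (step_of Q) x
      = (\<Sum>a\<in>?A. \<Sum>b\<in>?B. of_int (P a * Q b) * (LINT y|lebesgue. indicat_real {b..x - a} y))"
    unfolding convolution_def eq using int by (simp add: Bochner_Integration.integral_sum)
  moreover have "(LINT y|lebesgue. indicat_real {b..x - a} y) = max 0 (x - (a + b))" for a b
    by (simp add: max_def)
  ultimately show "convolution (step_of P) (step_of Q) x
      = (\<Sum>a\<in>?A. \<Sum>b\<in>?B. of_int (P a * Q b) * max 0 (x - (a + b)))" by simp
qed

lemma integrable_step_of_test_function:
  assumes P: "left_finite P" and \<phi>: "\<phi> \<in> test_functions"
  shows "integrable lebesgue (\<lambda>x. step_of P x * \<phi> x)"
proof -
  obtain M where M: "\<And>x. x > M \<Longrightarrow> \<phi> x = 0" using test_function_bound[OF \<phi>] by blast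
  have "step_of P x * \<phi> x = (\<Sum>a\<in>exponents_upto M P. of_int (P a) * (indicat_real {a..} x * \<phi> x))" for x
    using M[of x] step_of_eq_sum_below[OF P, of x M]
    by (cases "x \<le> M") (auto simp: sum_distrib_right mult.assoc)
  then show ?thesis
    using integrable_indicator_test_function[OF \<phi>]
    by (simp add: Bochner_Integration.integrable_sum)
qed

text \<open>
  The heart of the matter: convolving turns the jumps at \<open>a\<close> and \<open>b\<close> into a ramp starting at \<open>a + b\<close>, and
  differentiating turns the ramp back into a jump at \<open>a + b\<close>. Hence \<open>D (\<sigma>\<^sub>1 * \<sigma>\<^sub>2)\<close> multiplies
  jumps in the way Novikov series multiply.
\<close>

theorem distributional_deriv_convolution:
  assumes lf: "left_finite P" "left_finite Q"
  shows "distributional_deriv (regular_distribution (convolution (step_of P) (step_of Q)))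
    = regular_distribution (step_of (novikov_mult P Q))"
proof
  fix \<phi>
  show "distributional_deriv (regular_distribution (convolution (step_of P) (step_of Q))) \<phi>
    = regular_distribution (step_of (novikov_mult P Q)) \<phi>"
  proof (cases "\<phi> \<in> test_functions")
    case \<phi>: True
    note \<phi>' = test_function_deriv[OF \<phi>]
    obtain d where d: "vanishes_below d P" "vanishes_below d Q"
      using left_finite_common_bound[OF lf] by blast
    obtain M1 where M1: "\<And>x. x > M1 \<Longrightarrow> \<phi> x = 0" using test_function_bound[OF \<phi>] by blast
    obtain M2 where M2: "\<And>x. x > M2 \<Longrightarrow> deriv \<phi> x = 0" using test_function_bound[OF \<phi>'] by blast
    define M where "M = max M1 M2"
    let ?A = "exponents_upto (M - d) P" and ?B = "exponents_upto (M - d) Q"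
    have conv: "convolution (step_of P) (step_of Q) x * deriv \<phi> x
      = (\<Sum>a\<in>?A. \<Sum>b\<in>?B. of_int (P a * Q b) * (max 0 (x - (a + b)) * deriv \<phi> x))" for x
      using M2[of x] step_of_convolution(2)[OF lf d, of x "M - d"]
      by (cases "x \<le> M") (auto simp: M_def sum_distrib_right mult.assoc)
    have prod: "step_of (novikov_mult P Q) x * \<phi> x
      = (\<Sum>a\<in>?A. \<Sum>b\<in>?B. of_int (P a * Q b) * (indicat_real {a + b..} x * \<phi> x))" for x
      using M1[of x] step_of_novikov_mult[OF lf d, of x "M - d"]
      by (cases "x \<le> M") (auto simp: M_def sum_distrib_right mult.assoc)
    have "(LINT x|lebesgue. convolution (step_of P) (step_of Q) x * deriv \<phi> x)
      = (\<Sum>a\<in>?A. \<Sum>b\<in>?B. of_int (P a * Q b) * (LINT x|lebesgue. max 0 (x - (a + b)) * deriv \<phi> x))"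
      unfolding conv using ramp_derivative(1)[OF \<phi>]
      by (simp add: Bochner_Integration.integral_sum Bochner_Integration.integrable_sum)
    also have "\<dots> = - (\<Sum>a\<in>?A. \<Sum>b\<in>?B. of_int (P a * Q b) * (LINT x|lebesgue. indicat_real {a + b..} x * \<phi> x))"
      unfolding ramp_derivative(2)[OF \<phi>] by (simp add: sum_negf)
    also have "(\<Sum>a\<in>?A. \<Sum>b\<in>?B. of_int (P a * Q b) * (LINT x|lebesgue. indicat_real {a + b..} x * \<phi> x))
      = (LINT x|lebesgue. step_of (novikov_mult P Q) x * \<phi> x)"
      unfolding prod using integrable_indicator_test_function[OF \<phi>]
      by (simp add: Bochner_Integration.integral_sum Bochner_Integration.integrable_sum)
    finally show ?thesis
      using \<phi> \<phi>' by (simp add: distributional_deriv_def regular_distribution_def)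
  qed (simp add: distributional_deriv_def regular_distribution_def)
qed

section \<open>Local integrability\<close>

text \<open>
  Ramps are written as a continuous factor times an indicator, so that this criterion covers both
  the step functions and their convolutions. The summands are indexed by an arbitrary type, since
  convolutions need pairs of exponents.
\<close>

lemma locally_integrableI:
  fixes f :: "real \<Rightarrow> real"
  assumes "\<And>c. \<exists>(A::'a set) s g. finite A
    \<and> (\<forall>a\<in>A. \<forall>x. isCont (g a) x) \<and> (\<forall>x\<le>c. f x = (\<Sum>a\<in>A. g a x * indicat_real {s a..} x))"
  shows "locally_integrable f"
  unfolding locally_integrable_def
proof (intro allI impI)
  fix K :: "real set" assume K: "compact K"
  then obtain c where c: "\<And>x. x \<in> K \<Longrightarrow> x \<le> c"
    using compact_imp_bounded bounded_imp_bdd_above unfolding bdd_above_def by metis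
  obtain A :: "'a set" and s g where A: "finite A" "\<And>a x. a \<in> A \<Longrightarrow> isCont (g a) x"
    "\<And>x. x \<le> c \<Longrightarrow> f x = (\<Sum>a\<in>A. g a x * indicat_real {s a..} x)"
    using assms[of c] by blast
  have eq: "(\<lambda>x. indicat_real K x *\<^sub>R f x) = (\<lambda>x. \<Sum>a\<in>A. indicat_real (K \<inter> {s a..}) x *\<^sub>R g a x)"
    using A(3) c by (auto simp: fun_eq_iff indicator_def intro!: sum.cong)
  have "integrable lebesgue (\<lambda>x. indicat_real (K \<inter> {s a..}) x *\<^sub>R g a x)" if "a \<in> A" for a
  proof -
    have "integrable lborel (\<lambda>x. indicat_real (K \<inter> {s a..}) x *\<^sub>R g a x)"
      using K A(2)[OF that]
      by (intro borel_integrable_compact compact_Int_closed continuous_at_imp_continuous_on) auto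
    then show ?thesis by (simp add: integrable_completion)
  qed
  then show "f absolutely_integrable_on K"
    unfolding set_integrable_def eq by (rule Bochner_Integration.integrable_sum)
qed

lemma locally_integrable_step_of:
  assumes "left_finite P"
  shows "locally_integrable (step_of P)"
proof (rule locally_integrableI)
  fix c
  show "\<exists>(A::real set) s g. finite A \<and> (\<forall>a\<in>A. \<forall>x. isCont (g a) x)
    \<and> (\<forall>x\<le>c. step_of P x = (\<Sum>a\<in>A. g a x * indicat_real {s a..} x))"
    using step_of_eq_sum_below[OF assms] assms
    by (intro exI[of _ "exponents_upto c P"] exI[of _ "\<lambda>a. a"] exI[of _ "\<lambda>a _. of_int (P a)"]) auto
qed

lemma locally_integrable_convolution_step_of:
  assumes lf: "left_finite P" "left_finite Q"
  shows "locally_integrable (convolution (step_of P) (step_of Q))"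
proof (rule locally_integrableI)
  fix c
  obtain d where d: "vanishes_below d P" "vanishes_below d Q"
    using left_finite_common_bound[OF lf] by blast
  let ?A = "exponents_upto (c - d) P" and ?B = "exponents_upto (c - d) Q"
  have "convolution (step_of P) (step_of Q) x
    = (\<Sum>(a, b)\<in>?A \<times> ?B. of_int (P a * Q b) * (x - (a + b)) * indicat_real {a + b..} x)" if "x \<le> c" for x
    unfolding sum.cartesian_product[symmetric] using that
    by (subst step_of_convolution(2)[OF lf d, of x "c - d"])
       (auto intro!: sum.cong simp: indicator_def)
  then show "\<exists>(A::(real \<times> real) set) s g. finite A \<and> (\<forall>p\<in>A. \<forall>x. isCont (g p) x)
    \<and> (\<forall>x\<le>c. convolution (step_of P) (step_of Q) x = (\<Sum>p\<in>A. g p x * indicat_real {s p..} x))"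
    using lf by (intro exI[of _ "?A \<times> ?B"] exI[of _ "\<lambda>(a, b). a + b"]
        exI[of _ "\<lambda>(a, b) x. of_int (P a * Q b) * (x - (a + b))"])
      (auto simp: case_prod_unfold)
qed

section \<open>Bump functions\<close>

text \<open>
  For \<open>p = 1\<close> this is the standard smooth function \<open>exp (- 1 / x)\<close>, extended by zero, which is flat
  at the origin. Allowing polynomial factors in \<open>1 / x\<close> makes the family closed under differentiation.
\<close>

definition flat :: "real poly \<Rightarrow> real \<Rightarrow> real" where
  "flat p x = (if x > 0 then poly p (1 / x) * exp (- (1 / x)) else 0)"

lemma poly_times_exp_minus_tendsto_0: "tendsto (\<lambda>y::real. poly p y * exp (- y)) 0 at_top"
proof -
  have "tendsto (\<lambda>y. \<Sum>i\<le>Polynomial.degree p. Polynomial.coeff p i * (y ^ i / exp y)) ((\<Sum>i\<le>Polynomial.degree p. Polynomial.coeff p i * 0)) at_top"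
    by (intro tendsto_intros tendsto_power_div_exp_0)
  moreover have "(\<lambda>y. \<Sum>i\<le>Polynomial.degree p. Polynomial.coeff p i * (y ^ i / exp y)) = (\<lambda>y. poly p y * exp (- y))"
    by (auto simp: fun_eq_iff poly_altdef sum_distrib_right exp_minus divide_inverse mult.assoc)
  ultimately show ?thesis by simp
qed

lemma flat_tendsto_0: "tendsto (flat p) 0 (at 0)"
proof (rule filterlim_split_at)
  have "eventually (\<lambda>x. 0 = flat p x) (at_left 0)"
    by (auto simp: eventually_at_filter flat_def)
  then show "tendsto (flat p) 0 (at_left 0)"
    by (rule Lim_transform_eventually[OF tendsto_const])
  have "tendsto (\<lambda>x. poly p (inverse x) * exp (- inverse x)) 0 (at_right 0)"
    using poly_times_exp_minus_tendsto_0 filterlim_inverse_at_top_right by (rule filterlim_compose)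
  moreover have "eventually (\<lambda>x. poly p (inverse x) * exp (- inverse x) = flat p x) (at_right 0)"
    by (auto simp: eventually_at_filter flat_def inverse_eq_divide)
  ultimately show "tendsto (flat p) 0 (at_right 0)"
    by (rule Lim_transform_eventually)
qed

text \<open>
  The chain rule contributes the factor \<open>y\<^sup>2\<close> with \<open>y = 1 / x\<close>, the derivative of \<open>- 1 / x\<close>.
\<close>

definition flat_deriv :: "real poly \<Rightarrow> real poly" where
  "flat_deriv p = [:0, 0, 1:] * (p - pderiv p)"

lemma DERIV_flat: "DERIV (flat p) x :> flat (flat_deriv p) x"
proof -
  consider "x > 0" | "x < 0" | "x = 0" by linarith
  then show ?thesis
  proof cases
    case 1
    have "DERIV (\<lambda>x. poly p (1 / x) * exp (- (1 / x))) x :> flat (flat_deriv p) x"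
      using 1 by (auto intro!: derivative_eq_intros simp: flat_def flat_deriv_def field_simps power2_eq_square)
    moreover have "eventually (\<lambda>x. flat p x = poly p (1 / x) * exp (- (1 / x))) (nhds x)"
      using eventually_nhds_in_open[of "{0<..}" x] 1 by (auto elim!: eventually_mono simp: flat_def)
    ultimately show ?thesis by (subst DERIV_cong_ev[OF refl _ refl])
  next
    case 2
    have "DERIV (\<lambda>x. 0) x :> flat (flat_deriv p) x" using 2 by (simp add: flat_def)
    moreover have "eventually (\<lambda>x. flat p x = 0) (nhds x)"
      using eventually_nhds_in_open[of "{..<0}" x] 2 by (auto elim!: eventually_mono simp: flat_def)
    ultimately show ?thesis by (subst DERIV_cong_ev[OF refl _ refl])
  next
    case 3
    \<comment> \<open>the difference quotient at the origin belongs to the same family\<close>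
    have "(flat p (0 + h) - flat p 0) / h = flat (pCons 0 p) h" for h
      by (simp add: flat_def)
    then show ?thesis using flat_tendsto_0[of "pCons 0 p"] 3
      by (simp add: DERIV_def flat_def[of _ 0])
  qed
qed

text \<open>
  Each of the products vanishes outside \<open>(a, b)\<close>. By the product rule the class of their sums is
  closed under differentiation, so its members have derivatives of all orders.
\<close>

inductive bump_like :: "real \<Rightarrow> real \<Rightarrow> (real \<Rightarrow> real) \<Rightarrow> bool" for a b where
  product: "bump_like a b (\<lambda>x. flat p (x - a) * flat q (b - x))"
| sum: "bump_like a b f \<Longrightarrow> bump_like a b g \<Longrightarrow> bump_like a b (\<lambda>x. f x + g x)"

lemma bump_like_DERIV:
  assumes "bump_like a b f"
  shows "\<exists>g. bump_like a b g \<and> (\<forall>x. DERIV f x :> g x)"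
  using assms
proof induction
  case (product p q)
  have "DERIV (\<lambda>x. flat p (x - a) * flat q (b - x)) x :>
    flat (flat_deriv p) (x - a) * flat q (b - x) + flat p (x - a) * flat (- flat_deriv q) (b - x)" for x
  proof -
    have "flat (- r) y = - flat r y" for r y by (simp add: flat_def)
    then show ?thesis
      by (auto intro!: derivative_eq_intros DERIV_chain2[OF DERIV_flat])
  qed
  then show ?case by (blast intro: bump_like.intros)
next
  case (sum f g)
  then show ?case by (blast intro: bump_like.sum DERIV_add)
qed

lemma bump_like_iterated_deriv: "bump_like a b f \<Longrightarrow> bump_like a b ((deriv ^^ n) f)"
proof (induction n)
  case (Suc n)
  then obtain g where g: "bump_like a b g" "\<And>x. DERIV ((deriv ^^ n) f) x :> g x"
    using bump_like_DERIV by blast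
  then have "deriv ((deriv ^^ n) f) = g" using DERIV_imp_deriv by blast
  then show ?case using g(1) by simp
qed simp

lemma bump_function_exists:
  assumes "a < b"
  obtains \<phi> where "\<phi> \<in> test_functions" "\<And>x. \<phi> x \<ge> 0" "\<And>x. \<phi> x \<noteq> 0 \<longleftrightarrow> a < x \<and> x < b"
proof
  let ?\<phi> = "\<lambda>x. flat 1 (x - a) * flat 1 (b - x)"
  show nz: "?\<phi> x \<noteq> 0 \<longleftrightarrow> a < x \<and> x < b" and "?\<phi> x \<ge> 0" for x
    by (auto simp: flat_def)
  have "{x. ?\<phi> x \<noteq> 0} = {a<..<b}" unfolding nz by auto
  then have "compact (closure {x. ?\<phi> x \<noteq> 0})" by simp
  moreover have "(deriv ^^ n) ?\<phi> differentiable at x" for n x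
  proof -
    have "bump_like a b ((deriv ^^ n) ?\<phi>)"
      by (intro bump_like_iterated_deriv bump_like.product)
    from bump_like_DERIV[OF this] obtain g where "\<forall>x. DERIV ((deriv ^^ n) ?\<phi>) x :> g x" by blast
    then show ?thesis unfolding real_differentiable_def by blast
  qed
  ultimately show "?\<phi> \<in> test_functions" by (simp add: test_functions_def)
qed

section \<open>A step function is determined by its distribution\<close>

text \<open>
  By left-finiteness the least exponent is followed by a gap, in which the step function has the
  constant nonzero value \<open>R s\<close>.
\<close>

lemma step_of_constant_after_least_exponent:
  assumes "left_finite R" "vanishes_below s R" "R s \<noteq> 0"
  obtains b where "s < b" "\<And>x. s \<le> x \<Longrightarrow> x < b \<Longrightarrow> step_of R x = of_int (R s)"
proof -
  let ?N = "insert (s + 1) (exponents_upto (s + 1) R - {s})"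
  have fin: "finite ?N" using assms(1) by simp
  have gt: "\<And>a. a \<in> ?N \<Longrightarrow> s < a"
    using assms(2) unfolding exponents_upto_def vanishes_below_def by force
  then have "s < Min ?N" using fin by (subst Min_gr_iff) auto
  moreover have "step_of R x = of_int (R s)" if x: "s \<le> x" "x < Min ?N" for x
  proof -
    have x_less: "x < a" if "a \<in> ?N" for a using x(2) Min_le[OF fin that] by linarith
    have "exponents_upto x R = {s}"
    proof
      show "exponents_upto x R \<subseteq> {s}"
      proof
        fix a assume a: "a \<in> exponents_upto x R"
        then have "a \<notin> ?N" using x_less by (force simp: exponents_upto_def)
        moreover have "a \<in> exponents_upto (s + 1) R" using a x_less[of "s + 1"] by (auto simp: exponents_upto_def)
        ultimately show "a \<in> {s}" by blast
      qed
      show "{s} \<subseteq> exponents_upto x R" using x(1) assms(3) by (simp add: exponents_upto_def)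
    qed
    then show ?thesis by (simp add: step_of_def)
  qed
  ultimately show ?thesis using that by blast
qed

text \<open>
  If \<open>P\<close> and \<open>Q\<close> first differ at \<open>s\<close>, the step functions differ by a nonzero constant on an interval
  starting at \<open>s\<close>, and a bump function supported there detects the difference.
\<close>

theorem regular_distribution_step_of_inj:
  assumes lf: "left_finite P" "left_finite Q"
    and eq: "regular_distribution (step_of P) = regular_distribution (step_of Q)"
  shows "P = Q"
proof (rule ccontr)
  assume "P \<noteq> Q"
  then obtain R s where R: "left_finite R" "P = (\<lambda>a. Q a + R a)" "R s \<noteq> 0" "vanishes_below s R"
    by (rule least_exponent_of_difference[OF lf])
  obtain b where b: "s < b" "\<And>x. s \<le> x \<Longrightarrow> x < b \<Longrightarrow> step_of R x = of_int (R s)"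
    using step_of_constant_after_least_exponent[OF R(1,4,3)] by blast
  obtain \<phi> where \<phi>: "\<phi> \<in> test_functions" "\<And>x. \<phi> x \<ge> 0" "\<And>x. \<phi> x \<noteq> 0 \<longleftrightarrow> s < x \<and> x < b"
    using bump_function_exists[OF b(1)] by blast
  have "step_of P x * \<phi> x = step_of Q x * \<phi> x + step_of R x * \<phi> x" for x
    by (simp add: R(2) step_of_add[OF lf(2) R(1)] distrib_right)
  then have "(LINT x|lebesgue. step_of P x * \<phi> x)
    = (LINT x|lebesgue. step_of Q x * \<phi> x) + (LINT x|lebesgue. step_of R x * \<phi> x)"
    using integrable_step_of_test_function lf R(1) \<phi>(1) by simp
  moreover have "(LINT x|lebesgue. step_of P x * \<phi> x) = (LINT x|lebesgue. step_of Q x * \<phi> x)"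
    using fun_cong[OF eq, of \<phi>] \<phi>(1) by (simp add: regular_distribution_def)
  moreover have R\<phi>: "step_of R x * \<phi> x = of_int (R s) * \<phi> x" for x
    using b(2)[of x] \<phi>(3)[of x] by (cases "s < x \<and> x < b") auto
  ultimately have "(LINT x|lebesgue. \<phi> x) = 0" using R(3) by simp
  moreover have "integrable lebesgue (\<lambda>x. inverse (of_int (R s)) * (step_of R x * \<phi> x))"
    using integrable_step_of_test_function[OF R(1) \<phi>(1)] by simp
  then have "integrable lebesgue \<phi>" unfolding R\<phi> using R(3) by simp
  ultimately have "AE x in lebesgue. \<phi> x = 0"
    using \<phi>(2) by (subst (asm) integral_nonneg_eq_0_iff_AE) auto
  moreover have "\<phi> x = 0 \<longleftrightarrow> x \<notin> {s<..<b}" for x using \<phi>(3)[of x] by auto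
  ultimately have "AE x in lebesgue. x \<notin> {s<..<b}" by simp
  then have "{s<..<b} \<in> null_sets lebesgue" by (subst (asm) AE_iff_null_sets[symmetric]) auto
  then show False using b(1) by (simp add: null_sets_def)
qed

section \<open>Sums of interval indicators as step functions\<close>

lemma half_open_infinity: "half_open a \<infinity> = {a..}"
  by (auto simp: half_open_def)

lemma half_open_real: "half_open a (ereal b) = {a..<b}"
  by (auto simp: half_open_def)

lemma intervals_cases:
  assumes "I \<in> intervals"
  obtains a where "I = {a..}" | a b where "a < b" "I = {a..<b}"
proof -
  obtain a b where "I = half_open a b" "ereal a < b" using assms by (auto simp: intervals_def)
  then show ?thesis using that by (cases b) (auto simp: half_open_infinity half_open_real)
qed

lemma finite_intervals_cases:
  assumes "I \<in> finite_intervals"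
  obtains a b where "a < b" "I = {a..<b}"
proof -
  obtain a b where "I = half_open a b" "ereal a < b" "b < \<infinity>" using assms by (auto simp: finite_intervals_def)
  then show ?thesis using that by (cases b) (auto simp: half_open_real)
qed

lemma finite_intervals_subset: "finite_intervals \<subseteq> intervals"
  by (auto simp: finite_intervals_def intervals_def)

lemma atLeast_in_intervals: "{a..} \<in> intervals"
  unfolding intervals_def by (auto simp: half_open_infinity[symmetric] intro!: exI[of _ \<infinity>])

lemma atLeastLessThan_in_finite_intervals: "a < b \<Longrightarrow> {a..<b} \<in> finite_intervals"
  unfolding finite_intervals_def by (auto simp: half_open_real[symmetric] intro!: exI[of _ "ereal b"])

lemma Inf_interval [simp]: "Inf {a..} = (a::real)" "a < b \<Longrightarrow> Inf {a..<b} = (a::real)"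
  by (simp_all add: cInf_eq_minimum)

text \<open>
  The preimage of an interval indicator under \<open>step_of\<close>: \<open>t\<^sup>a - t\<^sup>b\<close> for \<open>[a, b)\<close>
  and \<open>t\<^sup>a\<close> for \<open>[a, \<infinity>)\<close>. It is expressed through \<open>Inf\<close> and \<open>Sup\<close> because the
  families in \<open>step_sum\<close> are sets of intervals and do not record the endpoints.
\<close>

definition interval_jumps :: "real set \<Rightarrow> real \<Rightarrow> int" where
  "interval_jumps I = (\<lambda>x. t_power (Inf I) x - (if bdd_above I then t_power (Sup I) x else 0))"

lemma interval_jumps_atLeast: "interval_jumps {a..} = t_power a"
proof -
  have "\<not> bdd_above {a..}"
  proof
    assume "bdd_above {a..}"
    then obtain M where "\<And>x. a \<le> x \<Longrightarrow> x \<le> M" by (auto simp: bdd_above_def)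
    moreover have "a \<le> max a M + 1" "\<not> max a M + 1 \<le> M" by linarith+
    ultimately show False by blast
  qed
  then show ?thesis by (simp add: interval_jumps_def)
qed

lemma interval_jumps_atLeastLessThan:
  "a < b \<Longrightarrow> interval_jumps {a..<b} = (\<lambda>x. t_power a x - t_power b x)"
  by (simp add: interval_jumps_def fun_eq_iff)

lemma interval_jumps:
  assumes "I \<in> intervals"
  shows "finite {y. interval_jumps I y \<noteq> 0}" "vanishes_below (Inf I) (interval_jumps I)"
    "step_of (interval_jumps I) = indicat_real I"
  using assms
proof (atomize (full), cases rule: intervals_cases)
  case (1 a)
  then show "finite {y. interval_jumps I y \<noteq> 0} \<and> vanishes_below (Inf I) (interval_jumps I)
    \<and> step_of (interval_jumps I) = indicat_real I"
    by (simp add: interval_jumps_atLeast step_of_t_power) (simp add: t_power_def vanishes_below_def)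
next
  case (2 a b)
  have "step_of (interval_jumps I) x = indicat_real I x" for x
    unfolding 2(2) interval_jumps_atLeastLessThan[OF 2(1)]
    by (subst step_of_eq_sum[of "{a, b}"])
       (use 2 in \<open>auto simp: t_power_def indicator_def split: if_splits\<close>)
  moreover have "{y. interval_jumps I y \<noteq> 0} \<subseteq> {a, b}"
    unfolding 2(2) interval_jumps_atLeastLessThan[OF 2(1)] by (auto simp: t_power_def split: if_splits)
  then have "finite {y. interval_jumps I y \<noteq> 0}" using finite_subset by blast
  moreover have "vanishes_below (Inf I) (interval_jumps I)"
    unfolding 2(2) interval_jumps_atLeastLessThan[OF 2(1)] using 2(1) by (auto simp: t_power_def vanishes_below_def)
  ultimately show "finite {y. interval_jumps I y \<noteq> 0} \<and> vanishes_below (Inf I) (interval_jumps I)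
    \<and> step_of (interval_jumps I) = indicat_real I" by blast
qed

lemma interval_indicator_before_Inf:
  assumes "I \<in> intervals" "x < Inf I"
  shows "indicat_real I x = 0"
  using assms(1) by (cases rule: intervals_cases) (use assms(2) in auto)

text \<open>
  The jumps of a sum of interval indicators are the sums of the jumps of the intervals. If only
  finitely many intervals begin to the left of any given point, each of these sums is finite and
  the result is again left-finite.
\<close>

lemma step_sum_eq_step_of:
  fixes n :: "real set \<Rightarrow> int"
  assumes I0: "\<I>\<^sub>0 \<subseteq> intervals" and fin: "\<And>c. finite {I\<in>\<I>\<^sub>0. Inf I \<le> c}"
  defines "P \<equiv> (\<lambda>y. \<Sum>I | I \<in> \<I>\<^sub>0 \<and> Inf I \<le> y. n I * interval_jumps I y)"
  shows "left_finite P" "step_sum \<I>\<^sub>0 n = step_of P"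
proof -
  define J where "J c = {I\<in>\<I>\<^sub>0. Inf I \<le> c}" for c
  define S where "S c = (\<Union>I\<in>J c. {y. interval_jumps I y \<noteq> 0})" for c
  have finJ: "finite (J c)" for c using fin by (simp add: J_def)
  have finS: "finite (S c)" for c
    unfolding S_def using finJ interval_jumps(1) I0 by (auto simp: J_def)
  have P: "P y = (\<Sum>I\<in>J c. n I * interval_jumps I y)" if "y \<le> c" for y c
    unfolding P_def J_def[symmetric]
  proof (rule sum.mono_neutral_left[OF finJ])
    show "J y \<subseteq> J c" using that by (auto simp: J_def)
    show "\<forall>I\<in>J c - J y. n I * interval_jumps I y = 0"
    proof
      fix I assume "I \<in> J c - J y"
      then have "I \<in> intervals" "y < Inf I" using I0 by (auto simp: J_def)
      then show "n I * interval_jumps I y = 0" using vanishes_belowD[OF interval_jumps(2)] by simp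
    qed
  qed
  have sub: "y \<in> S c" if y: "y \<le> c" "P y \<noteq> 0" for y c
  proof -
    obtain I where "I \<in> J c" "n I * interval_jumps I y \<noteq> 0"
      using P[OF y(1)] y(2) by (metis (no_types, lifting) sum.neutral)
    then show ?thesis by (auto simp: S_def)
  qed
  show "left_finite P" unfolding left_finite_def
  proof
    show "finite {a. a \<le> c \<and> P a \<noteq> 0}" for c
      by (rule finite_subset[OF _ finS[of c]]) (use sub in blast)
  qed
  show "step_sum \<I>\<^sub>0 n = step_of P"
  proof
    fix x
    have "step_sum \<I>\<^sub>0 n x = (\<Sum>\<^sub>\<infinity>I\<in>J x. of_int (n I) * indicat_real I x)"
      unfolding step_sum_def
    proof (rule infsum_cong_neutral)
      show "of_int (n I) * indicat_real I x = 0" if "I \<in> \<I>\<^sub>0 - J x" for I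
        using that I0 interval_indicator_before_Inf[of I x] by (auto simp: J_def)
    qed (auto simp: J_def)
    also have "\<dots> = (\<Sum>I\<in>J x. of_int (n I) * step_of (interval_jumps I) x)"
    proof -
      have "step_of (interval_jumps I) = indicat_real I" if "I \<in> J x" for I
        using that I0 by (intro interval_jumps(3)) (auto simp: J_def)
      then show ?thesis using finJ by (simp add: infsum_finite)
    qed
    also have "\<dots> = (\<Sum>I\<in>J x. of_int (n I) * (\<Sum>a\<in>S x. of_int (interval_jumps I a) * indicat_real {a..} x))"
    proof (intro sum.cong refl arg_cong2[where f = "(*)"] step_of_eq_sum finS)
      show "a \<in> S x" if "I \<in> J x" "interval_jumps I a \<noteq> 0" for I a using that by (auto simp: S_def)
    qed
    also have "\<dots> = (\<Sum>a\<in>S x. \<Sum>I\<in>J x. of_int (n I) * (of_int (interval_jumps I a) * indicat_real {a..} x))"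
      unfolding sum_distrib_left by (rule sum.swap)
    also have "\<dots> = (\<Sum>a\<in>S x. of_int (P a) * indicat_real {a..} x)"
    proof (intro sum.cong refl)
      fix a
      show "(\<Sum>I\<in>J x. of_int (n I) * (of_int (interval_jumps I a) * indicat_real {a..} x))
        = of_int (P a) * indicat_real {a..} x"
        using P[of a x] by (cases "a \<le> x") (simp_all add: sum_distrib_right mult.assoc)
    qed
    also have "\<dots> = step_of P x" by (rule step_of_eq_sum[symmetric, OF finS sub])
    finally show "step_sum \<I>\<^sub>0 n x = step_of P x" .
  qed
qed

lemma step_sum_finite_eq_step_of:
  assumes I0: "\<I>\<^sub>0 \<subseteq> intervals" and fin: "finite \<I>\<^sub>0"
  shows "step_sum \<I>\<^sub>0 n = step_of (\<lambda>y. \<Sum>I\<in>\<I>\<^sub>0. n I * interval_jumps I y)"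
    and "finite {y. (\<Sum>I\<in>\<I>\<^sub>0. n I * interval_jumps I y) \<noteq> 0}"
proof -
  have "(\<Sum>I | I \<in> \<I>\<^sub>0 \<and> Inf I \<le> y. n I * interval_jumps I y) = (\<Sum>I\<in>\<I>\<^sub>0. n I * interval_jumps I y)" for y
    using I0 by (intro sum.mono_neutral_left fin) (auto intro!: vanishes_belowD[OF interval_jumps(2)] simp: not_le)
  then show "step_sum \<I>\<^sub>0 n = step_of (\<lambda>y. \<Sum>I\<in>\<I>\<^sub>0. n I * interval_jumps I y)"
    using step_sum_eq_step_of(2)[OF I0, of n] fin by simp
  have "finite (\<Union>I\<in>\<I>\<^sub>0. {y. interval_jumps I y \<noteq> 0})" using fin interval_jumps(1) I0 by blast
  moreover have "{y. (\<Sum>I\<in>\<I>\<^sub>0. n I * interval_jumps I y) \<noteq> 0} \<subseteq> (\<Union>I\<in>\<I>\<^sub>0. {y. interval_jumps I y \<noteq> 0})"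
  proof
    fix y assume "y \<in> {y. (\<Sum>I\<in>\<I>\<^sub>0. n I * interval_jumps I y) \<noteq> 0}"
    then obtain I where "I \<in> \<I>\<^sub>0" "n I * interval_jumps I y \<noteq> 0" by (meson mem_Collect_eq sum.neutral)
    then show "y \<in> (\<Union>I\<in>\<I>\<^sub>0. {y. interval_jumps I y \<noteq> 0})" by auto
  qed
  ultimately show "finite {y. (\<Sum>I\<in>\<I>\<^sub>0. n I * interval_jumps I y) \<noteq> 0}" by (rule finite_subset[rotated])
qed

text \<open>
  Conversely a series is realized by the unbounded intervals \<open>[a, \<infinity>)\<close>, one for each exponent. The
  superset \<open>A\<close> of the support leaves room for the intervals with coefficient zero that turn a finite family
  into a sequence.
\<close>

lemma step_of_eq_step_sum:
  assumes P: "left_finite P" and A: "{a. P a \<noteq> 0} \<subseteq> A"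
  shows "step_of P = step_sum ((\<lambda>a. {a..}) ` A) (\<lambda>I. P (Inf I))"
proof
  fix x
  have "step_sum ((\<lambda>a. {a..}) ` A) (\<lambda>I. P (Inf I)) x = (\<Sum>\<^sub>\<infinity>a\<in>A. of_int (P a) * indicat_real {a..} x)"
    unfolding step_sum_def by (subst infsum_reindex) (auto simp: inj_on_def comp_def)
  also have "\<dots> = (\<Sum>\<^sub>\<infinity>a\<in>exponents_upto x P. of_int (P a) * indicat_real {a..} x)"
    using A by (intro infsum_cong_neutral) (auto simp: exponents_upto_def indicator_def)
  also have "\<dots> = step_of P x"
    unfolding step_of_eq_sum_below[OF P order_refl] using P by (intro infsum_finite) simp
  finally show "step_of P x = step_sum ((\<lambda>a. {a..}) ` A) (\<lambda>I. P (Inf I)) x" by simp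
qed

theorem LC_eq_image: "LC = step_of ` \<Lambda>"
proof (intro Set.equalityI Set.subsetI)
  fix \<sigma> assume "\<sigma> \<in> LC"
  then obtain \<I>\<^sub>0 n where \<sigma>: "\<sigma> = step_sum \<I>\<^sub>0 n" and I0: "\<I>\<^sub>0 \<subseteq> intervals"
    and disj: "finite \<I>\<^sub>0 \<or> (\<exists>(a :: nat \<Rightarrow> real) (b :: nat \<Rightarrow> ereal).
               (\<forall>j. ereal (a j) < b j) \<and> filterlim a at_top sequentially \<and>
               \<I>\<^sub>0 = range (\<lambda>j. half_open (a j) (b j)))"
    unfolding LC_def by blast
  have "finite {I\<in>\<I>\<^sub>0. Inf I \<le> c}" for c
    using disj
  proof (elim disjE exE conjE)
    fix a :: "nat \<Rightarrow> real" and b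
    assume ab: "\<forall>j. ereal (a j) < b j" "filterlim a at_top sequentially"
      "\<I>\<^sub>0 = range (\<lambda>j. half_open (a j) (b j))"
    have "Inf (half_open (a j) (b j)) = a j" for j
      using ab(1)[rule_format, of j] by (cases "b j") (simp_all add: half_open_real half_open_infinity)
    then have "{I\<in>\<I>\<^sub>0. Inf I \<le> c} \<subseteq> (\<lambda>j. half_open (a j) (b j)) ` {j. a j \<le> c}"
      unfolding ab(3) by auto
    moreover have "finite {j. a j \<le> c}" using ab(2) filterlim_at_top_iff_finite_initial by blast
    ultimately show ?thesis using finite_subset by blast
  qed simp
  then show "\<sigma> \<in> step_of ` \<Lambda>"
    using step_sum_eq_step_of[OF I0, of n] unfolding \<sigma> \<Lambda>_eq_left_finite by blast
next
  fix \<sigma> assume "\<sigma> \<in> step_of ` \<Lambda>"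
  then obtain P where P: "left_finite P" "\<sigma> = step_of P" by (auto simp: \<Lambda>_eq_left_finite)
  obtain f :: "nat \<Rightarrow> real" where f: "filterlim f at_top sequentially" "{a. P a \<noteq> 0} \<subseteq> range f"
    using left_finite_exponents_enumeration[OF P(1)] by blast
  have eq: "(\<lambda>a. {a..}) ` range f = range (\<lambda>j. half_open (f j) \<infinity>)"
    by (auto simp: half_open_infinity)
  have sum: "\<sigma> = step_sum (range (\<lambda>j. half_open (f j) \<infinity>)) (\<lambda>I. P (Inf I))"
    using step_of_eq_step_sum[OF P(1) f(2)] P(2) eq by simp
  have sub: "range (\<lambda>j. half_open (f j) \<infinity>) \<subseteq> intervals"
    by (auto simp: half_open_infinity atLeast_in_intervals)
  have seq: "\<exists>(a :: nat \<Rightarrow> real) (b :: nat \<Rightarrow> ereal). (\<forall>j. ereal (a j) < b j) \<and>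
    filterlim a at_top sequentially \<and> range (\<lambda>j. half_open (f j) \<infinity>) = range (\<lambda>j. half_open (a j) (b j))"
    using f(1) by (intro exI[of _ f] exI[of _ "\<lambda>_. \<infinity>"]) simp
  show "\<sigma> \<in> LC"
    unfolding LC_def mem_Collect_eq by (rule exI, rule exI, intro conjI disjI2) (rule sum sub seq)+
qed

theorem LC\<^sub>B_eq_image: "LC\<^sub>B = step_of ` \<Lambda>\<^sub>P"
proof (intro Set.equalityI Set.subsetI)
  fix \<sigma> assume "\<sigma> \<in> LC\<^sub>B"
  then obtain \<I>\<^sub>0 n where "\<sigma> = step_sum \<I>\<^sub>0 n" "finite \<I>\<^sub>0" "\<I>\<^sub>0 \<subseteq> intervals"
    unfolding LC\<^sub>B_def by blast
  then show "\<sigma> \<in> step_of ` \<Lambda>\<^sub>P"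
    using step_sum_finite_eq_step_of[of \<I>\<^sub>0 n] unfolding \<Lambda>\<^sub>P_eq_finite_support by blast
next
  fix \<sigma> assume "\<sigma> \<in> step_of ` \<Lambda>\<^sub>P"
  then obtain P where P: "finite {a. P a \<noteq> 0}" "\<sigma> = step_of P" by (auto simp: \<Lambda>\<^sub>P_eq_finite_support)
  have "\<sigma> = step_sum ((\<lambda>a. {a..}) ` {a. P a \<noteq> 0}) (\<lambda>I. P (Inf I))"
    unfolding P(2) by (intro step_of_eq_step_sum finite_support_imp_left_finite P(1) order_refl)
  moreover have "(\<lambda>a. {a..}) ` {a. P a \<noteq> 0} \<subseteq> intervals" using atLeast_in_intervals by blast
  ultimately show "\<sigma> \<in> LC\<^sub>B" unfolding LC\<^sub>B_def using P(1) by blast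
qed

text \<open>
  The jumps of a bounded interval add up to zero. Conversely, if the coefficients of a finite sum
  add up to zero and \<open>M\<close> lies to the right of all its exponents, then its step function vanishes from \<open>M\<close>
  on, so cutting off the intervals \<open>[a, \<infinity>)\<close> at \<open>M\<close> does not change their sum.
\<close>

theorem LC\<^sub>B'_eq_image: "LC\<^sub>B' = step_of ` \<Lambda>\<^sub>P\<^sub>0"
proof (intro Set.equalityI Set.subsetI)
  fix \<sigma> assume "\<sigma> \<in> LC\<^sub>B'"
  then obtain \<I>\<^sub>0 n where \<sigma>: "\<sigma> = step_sum \<I>\<^sub>0 n" "finite \<I>\<^sub>0" and sub: "\<I>\<^sub>0 \<subseteq> finite_intervals"
    unfolding LC\<^sub>B'_def by blast
  then have I0: "\<I>\<^sub>0 \<subseteq> intervals" using finite_intervals_subset by blast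
  let ?P = "\<lambda>y. \<Sum>I\<in>\<I>\<^sub>0. n I * interval_jumps I y"
  let ?S = "(\<Union>I\<in>\<I>\<^sub>0. {y. interval_jumps I y \<noteq> 0})"
  have fin: "finite ?S" using \<sigma>(2) interval_jumps(1) I0 by blast
  have jumps0: "(\<Sum>y\<in>?S. interval_jumps I y) = 0" if I: "I \<in> \<I>\<^sub>0" for I
  proof -
    obtain a b where ab: "a < b" "I = {a..<b}" using I sub finite_intervals_cases by blast
    have "(\<Sum>y\<in>?S. interval_jumps I y) = eval_at_one (interval_jumps I)"
      by (rule eval_at_one_eq_sum[symmetric, OF fin]) (use I in blast)
    also have "\<dots> = (\<Sum>y\<in>{a, b}. interval_jumps I y)"
      unfolding ab(2) interval_jumps_atLeastLessThan[OF ab(1)]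
      by (rule eval_at_one_eq_sum) (auto simp: t_power_def split: if_splits)
    also have "\<dots> = 0"
      unfolding ab(2) interval_jumps_atLeastLessThan[OF ab(1)] using ab(1) by (simp add: t_power_def)
    finally show ?thesis .
  qed
  have "eval_at_one ?P = (\<Sum>y\<in>?S. ?P y)"
  proof (rule eval_at_one_eq_sum[OF fin], rule Set.subsetI)
    fix y assume "y \<in> {y. ?P y \<noteq> 0}"
    then obtain I where "I \<in> \<I>\<^sub>0" "n I * interval_jumps I y \<noteq> 0" by (meson mem_Collect_eq sum.neutral)
    then show "y \<in> ?S" by auto
  qed
  also have "\<dots> = (\<Sum>I\<in>\<I>\<^sub>0. n I * (\<Sum>y\<in>?S. interval_jumps I y))"
    unfolding sum_distrib_left by (rule sum.swap)
  also have "\<dots> = 0" using jumps0 by simp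
  finally have "?P \<in> \<Lambda>\<^sub>P\<^sub>0"
    using step_sum_finite_eq_step_of(2)[OF I0 \<sigma>(2)] by (simp add: \<Lambda>\<^sub>P\<^sub>0_def \<Lambda>\<^sub>P_eq_finite_support)
  then show "\<sigma> \<in> step_of ` \<Lambda>\<^sub>P\<^sub>0"
    unfolding \<sigma>(1) step_sum_finite_eq_step_of(1)[OF I0 \<sigma>(2)] by (rule imageI)
next
  fix \<sigma> assume "\<sigma> \<in> step_of ` \<Lambda>\<^sub>P\<^sub>0"
  then obtain P where P: "finite {a. P a \<noteq> 0}" "eval_at_one P = 0" "\<sigma> = step_of P"
    by (auto simp: \<Lambda>\<^sub>P_eq_finite_support \<Lambda>\<^sub>P\<^sub>0_def)
  let ?A = "{a. P a \<noteq> 0}"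
  obtain M where M: "\<And>a. a \<in> ?A \<Longrightarrow> a < M"
  proof
    show "a < Max ?A + 1" if "a \<in> ?A" for a using Max_ge[OF P(1) that] by linarith
  qed
  let ?I = "(\<lambda>a. {a..<M}) ` ?A"
  have inj: "inj_on (\<lambda>a. {a..<M}) ?A"
    by (rule inj_onI) (metis Inf_interval(2) M)
  have "step_sum ?I (\<lambda>I. P (Inf I)) x = step_of P x" for x
  proof -
    have "step_sum ?I (\<lambda>I. P (Inf I)) x = (\<Sum>\<^sub>\<infinity>a\<in>?A. of_int (P (Inf {a..<M})) * indicat_real {a..<M} x)"
      unfolding step_sum_def by (subst infsum_reindex[OF inj]) (simp add: comp_def)
    also have "\<dots> = (\<Sum>a\<in>?A. of_int (P a) * indicat_real {a..<M} x)"
      using P(1) M by (auto intro!: sum.cong)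
    also have "\<dots> = (\<Sum>a\<in>?A. of_int (P a) * indicat_real {a..} x)"
    proof (cases "x < M")
      case True
      then show ?thesis by (intro sum.cong) (auto simp: indicator_def)
    next
      case False
      have "(\<Sum>a\<in>?A. of_int (P a) * indicat_real {a..} x) = (\<Sum>a\<in>?A. of_int (P a))"
        using False M by (intro sum.cong) (force simp: indicator_def)+
      also have "\<dots> = 0" using P(2) by (simp add: eval_at_one_def flip: of_int_sum)
      finally show ?thesis using False by simp
    qed
    also have "\<dots> = step_of P x" using P(1) by (intro step_of_eq_sum[symmetric]) auto
    finally show ?thesis .
  qed
  then have "\<sigma> = step_sum ?I (\<lambda>I. P (Inf I))" using P(3) by auto
  moreover have "?I \<subseteq> finite_intervals" using M atLeastLessThan_in_finite_intervals by blast
  ultimately show "\<sigma> \<in> LC\<^sub>B'" unfolding LC\<^sub>B'_def using P(1) by blast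
qed

section \<open>The ring of step functions\<close>

text \<open>
  Existence is the computation of the derivative of the convolution, uniqueness is the injectivity of
  \<open>P \<mapsto> regular_distribution (step_of P)\<close>.
\<close>

theorem circ_unique:
  assumes lf: "left_finite P" "left_finite Q"
  shows "\<sigma> \<in> LC \<and> distributional_deriv (regular_distribution (convolution (step_of P) (step_of Q)))
    = regular_distribution \<sigma> \<longleftrightarrow> \<sigma> = step_of (novikov_mult P Q)"
proof -
  have PQ: "left_finite (novikov_mult P Q)" using lf by (rule left_finite_novikov_mult)
  have "\<sigma> = step_of (novikov_mult P Q)"
    if \<sigma>: "\<sigma> \<in> LC" "regular_distribution (step_of (novikov_mult P Q)) = regular_distribution \<sigma>"
  proof -
    obtain R where R: "left_finite R" "\<sigma> = step_of R"
      using \<sigma>(1) by (auto simp: LC_eq_image \<Lambda>_eq_left_finite)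
    then show ?thesis using regular_distribution_step_of_inj[OF PQ R(1)] \<sigma>(2) by simp
  qed
  moreover have "step_of (novikov_mult P Q) \<in> LC"
    using PQ by (simp add: LC_eq_image \<Lambda>_eq_left_finite)
  ultimately show ?thesis unfolding distributional_deriv_convolution[OF lf] by blast
qed

lemma circ_step_of:
  assumes lf: "left_finite P" "left_finite Q"
  shows "circ (step_of P) (step_of Q) = step_of (novikov_mult P Q)"
  unfolding circ_def circ_unique[OF lf] by (rule the_eq_trivial)

lemma step_of_hom:
  assumes "A \<subseteq> \<Lambda>"
  shows "step_of \<in> ring_hom (Novikov_ring\<lparr>carrier := A\<rparr>) (LC_ring\<lparr>carrier := step_of ` A\<rparr>)"
  using assms
  by (intro ring_hom_memI)
     (auto simp: LC_ring_def \<Lambda>_eq_left_finite circ_step_of step_of_t_power step_of_add subset_iff)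

text \<open>
  The carrier is a parameter so that \<open>\<Lambda>\<close> and \<open>\<Lambda>\<^sub>P\<close> are treated at once.
\<close>

lemma step_of_iso:
  assumes "A \<subseteq> \<Lambda>"
  shows "step_of \<in> ring_iso (Novikov_ring\<lparr>carrier := A\<rparr>) (LC_ring\<lparr>carrier := step_of ` A\<rparr>)"
  unfolding ring_iso_def using step_of_hom[OF assms] inj_on_subset[OF step_of_inj] assms
  by (simp add: bij_betw_def \<Lambda>_eq_left_finite)

lemma Novikov_carrier: "Novikov_ring\<lparr>carrier := \<Lambda>\<rparr> = Novikov_ring"
  by (simp add: Novikov_ring_def)

lemma LC_carrier: "LC_ring\<lparr>carrier := step_of ` \<Lambda>\<rparr> = LC_ring"
  by (simp add: LC_ring_def LC_eq_image)

lemma step_of_image_cring: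
  assumes "A \<subseteq> \<Lambda>" "cring (Novikov_ring\<lparr>carrier := A\<rparr>)"
  shows "cring (LC_ring\<lparr>carrier := step_of ` A\<rparr>)"
  using cring.ring_iso_imp_img_cring[OF assms(2) step_of_iso[OF assms(1)]]
  by (simp add: LC_ring_def step_of_zero)

lemma ring_iso_image_ideal:
  assumes h: "h \<in> ring_iso R S" and R: "ring R" and S: "ring S" and I: "ideal I R"
  shows "ideal (h ` I) S"
proof -
  have hom: "h \<in> ring_hom R S" and surj: "carrier S = h ` carrier R"
    using h by (auto simp: ring_iso_def bij_betw_def)
  interpret h: ring_hom_ring R S h by (intro ring_hom_ringI2 R S hom)
  interpret I: ideal I R by (rule I)
  show ?thesis
  proof (rule idealI[OF S])
    show "subgroup (h ` I) (add_monoid S)"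
      using h.a_group_hom I.a_subgroup by (rule group_hom.subgroup_img_is_subgroup)
  next
    fix y z assume "y \<in> h ` I" "z \<in> carrier S"
    then obtain a x where "y = h a" "a \<in> I" "z = h x" "x \<in> carrier R" using surj by auto
    then show "z \<otimes>\<^bsub>S\<^esub> y \<in> h ` I" "y \<otimes>\<^bsub>S\<^esub> z \<in> h ` I"
      using I.I_l_closed I.I_r_closed I.a_subset
      by (metis h.hom_mult imageI subsetD)+
  qed
qed

lemma \<Lambda>\<^sub>P_subset: "\<Lambda>\<^sub>P \<subseteq> \<Lambda>"
  by (auto simp: \<Lambda>\<^sub>P_eq_finite_support \<Lambda>_eq_left_finite finite_support_imp_left_finite)

text \<open>
  Composing \<open>\<theta>'\<close> with the inverse of \<open>step_of\<close> gives an endomorphism of the Novikov ring that fixes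
  the powers of \<open>t\<close>.
\<close>

lemma isomorphism_determined_by_t_powers:
  assumes \<theta>': "\<theta>' \<in> ring_iso Novikov_ring LC_ring" "\<And>a. \<theta>' (t_power a) = indicat_real {a..}"
    and P: "P \<in> \<Lambda>"
  shows "\<theta>' P = step_of P"
proof -
  have iso: "step_of \<in> ring_iso Novikov_ring LC_ring"
    using step_of_iso[of \<Lambda>] by (simp add: Novikov_carrier LC_carrier)
  define \<psi> where "\<psi> = inv_into (carrier Novikov_ring) step_of \<circ> \<theta>'"
  have inv: "inv_into (carrier Novikov_ring) step_of (step_of Q) = Q" if "left_finite Q" for Q
    using that step_of_inj by simp
  interpret Novikov_endomorphism \<psi>
  proof
    have "\<psi> \<in> ring_iso Novikov_ring Novikov_ring"
      unfolding \<psi>_def using ring_iso_set_trans[OF \<theta>'(1) ring_iso_set_sym[OF Nov.ring_axioms iso]] .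
    then show "\<psi> \<in> ring_hom Novikov_ring Novikov_ring" by (simp add: ring_iso_def)
    show "\<psi> (t_power a) = t_power a" for a
      using inv[OF left_finite_t_power, of a] by (simp add: \<psi>_def \<theta>'(2) step_of_t_power)
  qed
  have lf: "left_finite P" using P by (simp add: \<Lambda>_eq_left_finite)
  have "\<theta>' P \<in> LC" using \<theta>'(1) P by (auto simp: ring_iso_def ring_hom_def LC_ring_def \<Lambda>_eq_left_finite)
  then have "\<theta>' P \<in> step_of ` carrier Novikov_ring" by (simp add: LC_eq_image \<Lambda>_eq_left_finite)
  then have "step_of (\<psi> P) = \<theta>' P" by (simp add: \<psi>_def f_inv_into_f)
  then show ?thesis using identity[OF lf] by simp
qed

theorem proposition5p2p1:
  shows
    "(\<forall>\<sigma>\<in>LC. locally_integrable \<sigma>) \<and>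
     (\<forall>\<sigma>\<^sub>1\<in>LC. \<forall>\<sigma>\<^sub>2\<in>LC.
        (\<forall>x. integrable lebesgue (\<lambda>y. \<sigma>\<^sub>1 (x - y) * \<sigma>\<^sub>2 y)) \<and>
        locally_integrable (convolution \<sigma>\<^sub>1 \<sigma>\<^sub>2) \<and>
        (\<exists>!\<sigma>. \<sigma> \<in> LC \<and>
           distributional_deriv (regular_distribution (convolution \<sigma>\<^sub>1 \<sigma>\<^sub>2))
             = regular_distribution \<sigma>)) \<and>
     (\<forall>\<sigma>\<^sub>1\<in>LC\<^sub>B. \<forall>\<sigma>\<^sub>2\<in>LC\<^sub>B.
        circ \<sigma>\<^sub>1 \<sigma>\<^sub>2 \<in> LC\<^sub>B \<and>
        distributional_deriv (regular_distribution (convolution \<sigma>\<^sub>1 \<sigma>\<^sub>2))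
          = regular_distribution (circ \<sigma>\<^sub>1 \<sigma>\<^sub>2)) \<and>
     cring LC_ring \<and>
     cring (LC_ring\<lparr>carrier := LC\<^sub>B\<rparr>) \<and>
     ideal LC\<^sub>B' (LC_ring\<lparr>carrier := LC\<^sub>B\<rparr>) \<and>
     cring Novikov_ring \<and>
     subring \<Lambda>\<^sub>P Novikov_ring \<and>
     ideal \<Lambda>\<^sub>P\<^sub>0 (Novikov_ring\<lparr>carrier := \<Lambda>\<^sub>P\<rparr>) \<and>
     (\<exists>\<theta>. \<theta> \<in> ring_iso Novikov_ring LC_ring \<and>
          (\<forall>a. \<theta> (t_power a) = indicat_real {a..}) \<and>
          (\<forall>\<theta>'. \<theta>' \<in> ring_iso Novikov_ring LC_ring \<and>
                (\<forall>a. \<theta>' (t_power a) = indicat_real {a..}) \<longrightarrow>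
                (\<forall>P\<in>\<Lambda>. \<theta>' P = \<theta> P)) \<and>
          \<theta> \<in> ring_iso (Novikov_ring\<lparr>carrier := \<Lambda>\<^sub>P\<rparr>) (LC_ring\<lparr>carrier := LC\<^sub>B\<rparr>) \<and>
          \<theta> ` \<Lambda>\<^sub>P\<^sub>0 = LC\<^sub>B')"
proof -
  have LC: "\<exists>P. left_finite P \<and> \<sigma> = step_of P" if "\<sigma> \<in> LC" for \<sigma>
    using that by (auto simp: LC_eq_image \<Lambda>_eq_left_finite)
  have LC\<^sub>B: "\<exists>P. P \<in> \<Lambda>\<^sub>P \<and> left_finite P \<and> \<sigma> = step_of P" if "\<sigma> \<in> LC\<^sub>B" for \<sigma>
    using that \<Lambda>\<^sub>P_subset by (auto simp: LC\<^sub>B_eq_image \<Lambda>_eq_left_finite)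
  have 1: "\<forall>\<sigma>\<in>LC. locally_integrable \<sigma>"
    using LC locally_integrable_step_of by blast
  have 2: "\<forall>\<sigma>\<^sub>1\<in>LC. \<forall>\<sigma>\<^sub>2\<in>LC.
        (\<forall>x. integrable lebesgue (\<lambda>y. \<sigma>\<^sub>1 (x - y) * \<sigma>\<^sub>2 y)) \<and>
        locally_integrable (convolution \<sigma>\<^sub>1 \<sigma>\<^sub>2) \<and>
        (\<exists>!\<sigma>. \<sigma> \<in> LC \<and>
           distributional_deriv (regular_distribution (convolution \<sigma>\<^sub>1 \<sigma>\<^sub>2))
             = regular_distribution \<sigma>)"
  proof (intro ballI)
    fix \<sigma>\<^sub>1 \<sigma>\<^sub>2 assume "\<sigma>\<^sub>1 \<in> LC" "\<sigma>\<^sub>2 \<in> LC"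
    then obtain P Q where lf: "left_finite P" "left_finite Q" and \<sigma>: "\<sigma>\<^sub>1 = step_of P" "\<sigma>\<^sub>2 = step_of Q"
      using LC by blast
    obtain d where d: "vanishes_below d P" "vanishes_below d Q"
      using left_finite_common_bound[OF lf] by blast
    show "(\<forall>x. integrable lebesgue (\<lambda>y. \<sigma>\<^sub>1 (x - y) * \<sigma>\<^sub>2 y)) \<and>
        locally_integrable (convolution \<sigma>\<^sub>1 \<sigma>\<^sub>2) \<and>
        (\<exists>!\<sigma>. \<sigma> \<in> LC \<and>
           distributional_deriv (regular_distribution (convolution \<sigma>\<^sub>1 \<sigma>\<^sub>2))
             = regular_distribution \<sigma>)"
      unfolding \<sigma> circ_unique[OF lf]
      using step_of_convolution(1)[OF lf d order_refl] locally_integrable_convolution_step_of[OF lf]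
      by simp
  qed
  have 3: "\<forall>\<sigma>\<^sub>1\<in>LC\<^sub>B. \<forall>\<sigma>\<^sub>2\<in>LC\<^sub>B.
        circ \<sigma>\<^sub>1 \<sigma>\<^sub>2 \<in> LC\<^sub>B \<and>
        distributional_deriv (regular_distribution (convolution \<sigma>\<^sub>1 \<sigma>\<^sub>2))
          = regular_distribution (circ \<sigma>\<^sub>1 \<sigma>\<^sub>2)"
  proof (intro ballI)
    fix \<sigma>\<^sub>1 \<sigma>\<^sub>2 assume "\<sigma>\<^sub>1 \<in> LC\<^sub>B" "\<sigma>\<^sub>2 \<in> LC\<^sub>B"
    then obtain P Q where PQ: "P \<in> \<Lambda>\<^sub>P" "Q \<in> \<Lambda>\<^sub>P" and lf: "left_finite P" "left_finite Q"
      and \<sigma>: "\<sigma>\<^sub>1 = step_of P" "\<sigma>\<^sub>2 = step_of Q"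
      using LC\<^sub>B by metis
    have "novikov_mult P Q \<in> \<Lambda>\<^sub>P" using subringE(6)[OF \<Lambda>\<^sub>P_subring PQ] by simp
    then show "circ \<sigma>\<^sub>1 \<sigma>\<^sub>2 \<in> LC\<^sub>B \<and>
        distributional_deriv (regular_distribution (convolution \<sigma>\<^sub>1 \<sigma>\<^sub>2))
          = regular_distribution (circ \<sigma>\<^sub>1 \<sigma>\<^sub>2)"
      by (simp add: \<sigma> circ_step_of[OF lf] distributional_deriv_convolution[OF lf] LC\<^sub>B_eq_image)
  qed
  have 4: "cring LC_ring"
    using step_of_image_cring[of \<Lambda>] Novikov_ring_cring by (simp add: Novikov_carrier LC_carrier)
  have 5: "cring (LC_ring\<lparr>carrier := LC\<^sub>B\<rparr>)"
    unfolding LC\<^sub>B_eq_image by (rule step_of_image_cring[OF \<Lambda>\<^sub>P_subset \<Lambda>\<^sub>P_cring])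
  have iso: "step_of \<in> ring_iso Novikov_ring LC_ring"
    using step_of_iso[of \<Lambda>] by (simp add: Novikov_carrier LC_carrier)
  have iso_B: "step_of \<in> ring_iso (Novikov_ring\<lparr>carrier := \<Lambda>\<^sub>P\<rparr>) (LC_ring\<lparr>carrier := LC\<^sub>B\<rparr>)"
    unfolding LC\<^sub>B_eq_image by (rule step_of_iso[OF \<Lambda>\<^sub>P_subset])
  have 6: "ideal LC\<^sub>B' (LC_ring\<lparr>carrier := LC\<^sub>B\<rparr>)"
    unfolding LC\<^sub>B'_eq_image
    by (rule ring_iso_image_ideal[OF iso_B cring.axioms(1)[OF \<Lambda>\<^sub>P_cring] cring.axioms(1)[OF 5] \<Lambda>\<^sub>P\<^sub>0_ideal])
  show ?thesis
    using 1 2 3 4 5 6 Novikov_ring_cring \<Lambda>\<^sub>P_subring \<Lambda>\<^sub>P\<^sub>0_ideal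
  proof (intro conjI)
    show "\<exists>\<theta>. \<theta> \<in> ring_iso Novikov_ring LC_ring \<and>
          (\<forall>a. \<theta> (t_power a) = indicat_real {a..}) \<and>
          (\<forall>\<theta>'. \<theta>' \<in> ring_iso Novikov_ring LC_ring \<and>
                (\<forall>a. \<theta>' (t_power a) = indicat_real {a..}) \<longrightarrow>
                (\<forall>P\<in>\<Lambda>. \<theta>' P = \<theta> P)) \<and>
          \<theta> \<in> ring_iso (Novikov_ring\<lparr>carrier := \<Lambda>\<^sub>P\<rparr>) (LC_ring\<lparr>carrier := LC\<^sub>B\<rparr>) \<and>
          \<theta> ` \<Lambda>\<^sub>P\<^sub>0 = LC\<^sub>B'"
    proof (intro exI[of _ step_of] conjI allI impI ballI)
      show "step_of (t_power a) = indicat_real {a..}" for a by (rule step_of_t_power)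
      show "step_of ` \<Lambda>\<^sub>P\<^sub>0 = LC\<^sub>B'" by (rule LC\<^sub>B'_eq_image[symmetric])
    qed (use iso iso_B isomorphism_determined_by_t_powers in blast)+
  qed
qed

end
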